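(* Let $\mu$ be a positive Borel measure on $\mathbb{C}^n$ ($n\ge 1$) such that the monomials $z^\alpha$, $\alpha\in\mathbb{N}^n$, are pairwise orthogonal in $L^2(d\mu)$ and $0<\int|z^\alpha|^2\,d\mu<\infty$ for all $\alpha\in\mathbb{N}^n$. Then the canonical solution operator $S\colon A^2_{(0,1)}(d\mu)\to L^2(d\mu)$ to $\bar\partial$ is bounded if and only if there exists a constant $C$ such that $$\frac{c_{\gamma+e_p}}{c_{\gamma+2e_p}}-\frac{c_\gamma}{c_{\gamma+e_p}}<C$$ for all multiindices $\gamma\in\Gamma$ and all $p\in\{1,\dots,n\}$ with $\gamma+e_p\ge 0$.
   Context: $\mathbb{N}=\{0,1,2,\dots\}$. $A^2(d\mu)$ is the closure in $L^2(d\mu)$ of the linear span of the monomials $z^\alpha$, $\alpha\in\mathbb{N}^n$, and $c_\alpha=\left(\int|z^\alpha|^2\,d\mu\right)^{-1}$ for $\alpha\in\mathbb{N}^n$. $A^2_{(0,1)}(d\mu)$ is the Hilbert space of $(0,1)$-forms $\sum_{j=1}^n f_j\,d\bar z_j$ with $f_j\in A^2(d\mu)$, with norm squared $\sum_j\|f_j\|^2_{L^2(d\mu)}$. Multiindices: $\Gamma$ is the set of $\gamma\in\mathbb{Z}^n$ with all entries $\ge -1$ and at most one entry equal to $-1$. If $\gamma$ has an entry equal to $-1$, put $c_\gamma=0$. $e_j$ is the multiindex with $1$ in position $j$ and $0$ elsewhere; $\gamma+e_p\ge0$ means all entries of $\gamma+e_p$ are nonnegative. Canonical solution operator: $S\omega$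 is the solution $f\in L^2(d\mu)$ of $\bar\partial f=\omega$ that is orthogonal to $A^2(d\mu)$. Concretely, since $\bar\partial(\bar z_j z^\alpha)=z^\alpha d\bar z_j$, on the dense subspace of forms with polynomial coefficients (finite linear combinations of the $z^\alpha d\bar z_j$) $S$ is the linear map for which $S(z^\alpha d\bar z_j)$ is the unique element of $\bar z_j z^\alpha+A^2(d\mu)$ orthogonal to $A^2(d\mu)$. "$S$ is bounded" means that this densely defined map extends to a bounded operator $A^2_{(0,1)}(d\mu)\to L^2(d\mu)$. *)

theory Defs
  imports "HOL-Analysis.Analysis"
begin

text \<open>
  Elements of \<open>L\<^sup>2(d\<mu>)\<close> are represented by square-integrable functions, with equality of elements
  being equality almost everywhere.
\<close>

definition L2 :: "'a measure \<Rightarrow> ('a \<Rightarrow> complex) set" where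
  "L2 M = {f \<in> borel_measurable M. integrable M (\<lambda>z. (cmod (f z))\<^sup>2)}"

definition L2_inner :: "'a measure \<Rightarrow> ('a \<Rightarrow> complex) \<Rightarrow> ('a \<Rightarrow> complex) \<Rightarrow> complex" where
  "L2_inner M f g = (LINT z|M. f z * cnj (g z))"

definition L2_norm :: "'a measure \<Rightarrow> ('a \<Rightarrow> complex) \<Rightarrow> real" where
  "L2_norm M f = sqrt (LINT z|M. (cmod (f z))\<^sup>2)"

definition monomial :: "nat ^ 'n \<Rightarrow> complex ^ 'n \<Rightarrow> complex" where
  "monomial \<alpha> z = (\<Prod>j\<in>UNIV. (z $ j) ^ (\<alpha> $ j))"

definition polynomials :: "(complex ^ 'n \<Rightarrow> complex) set" where
  "polynomials = {(\<lambda>z. \<Sum>\<alpha>\<in>A. a \<alpha> * monomial \<alpha> z) | A a. finite A}"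

definition A2 :: "(complex ^ 'n) measure \<Rightarrow> (complex ^ 'n \<Rightarrow> complex) set" where
  "A2 M = {f \<in> L2 M. \<forall>e>0. \<exists>p\<in>polynomials. L2_norm M (\<lambda>z. f z - p z) < e}"

text \<open>
  A form \<open>\<Sum>\<^sub>j f\<^sub>j dzbar\<^sub>j\<close> is represented by the vector-valued function \<open>\<omega>\<close> with \<open>\<omega> z $ j = f\<^sub>j(z)\<close>.
\<close>

definition A2_form :: "(complex ^ 'n) measure \<Rightarrow> (complex ^ 'n \<Rightarrow> complex ^ 'n) set" where
  "A2_form M = {\<omega>. \<forall>j. (\<lambda>z. \<omega> z $ j) \<in> A2 M}"

definition form_norm :: "(complex ^ 'n) measure \<Rightarrow> (complex ^ 'n \<Rightarrow> complex ^ 'n) \<Rightarrow> real" where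
  "form_norm M \<omega> = sqrt (\<Sum>j\<in>UNIV. (L2_norm M (\<lambda>z. \<omega> z $ j))\<^sup>2)"

definition polynomial_form ::
  "((nat ^ 'n) \<times> 'n) set \<Rightarrow> (nat ^ 'n \<Rightarrow> 'n \<Rightarrow> complex) \<Rightarrow> complex ^ 'n \<Rightarrow> complex ^ 'n" where
  "polynomial_form A a z = (\<Sum>(\<alpha>, j)\<in>A. a \<alpha> j *s axis j (monomial \<alpha> z))"

text \<open>
  \<open>S(z\<^sup>\<alpha> dzbar\<^sub>j)\<close>: as \<open>zbar\<^sub>j z\<^sup>\<alpha>\<close> is one solution of the equation with this right-hand side,
  the solution orthogonal to \<open>A\<^sup>2(d\<mu>)\<close> lies in \<open>zbar\<^sub>j z\<^sup>\<alpha> + A\<^sup>2(d\<mu>)\<close>. The conditions determine it up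
  to equality almost everywhere, so the choice made here is one of a representative.
\<close>

definition canonical_solution ::
  "(complex ^ 'n) measure \<Rightarrow> nat ^ 'n \<Rightarrow> 'n \<Rightarrow> complex ^ 'n \<Rightarrow> complex" where
  "canonical_solution M \<alpha> j =
     (SOME u. u \<in> L2 M \<and>
              (\<lambda>z. u z - cnj (z $ j) * monomial \<alpha> z) \<in> A2 M \<and>
              (\<forall>g\<in>A2 M. L2_inner M u g = 0))"

text \<open>The value of the linear map \<open>S\<close> at \<open>polynomial_form A a\<close>.\<close>

definition canonical_solution_poly ::
  "(complex ^ 'n) measure \<Rightarrow> ((nat ^ 'n) \<times> 'n) set \<Rightarrow> (nat ^ 'n \<Rightarrow> 'n \<Rightarrow> complex) \<Rightarrow>
     complex ^ 'n \<Rightarrow> complex" where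
  "canonical_solution_poly M A a z = (\<Sum>(\<alpha>, j)\<in>A. a \<alpha> j * canonical_solution M \<alpha> j z)"

text \<open>
  Linearity holds modulo equality almost everywhere. That \<open>T\<close> respects this equality follows from
  linearity and the norm estimate.
\<close>

definition bounded_operator ::
  "(complex ^ 'n) measure \<Rightarrow> ((complex ^ 'n \<Rightarrow> complex ^ 'n) \<Rightarrow> complex ^ 'n \<Rightarrow> complex) \<Rightarrow> bool" where
  "bounded_operator M T \<longleftrightarrow>
     (\<forall>\<omega>\<in>A2_form M. T \<omega> \<in> L2 M) \<and>
     (\<forall>\<omega>\<in>A2_form M. \<forall>\<eta>\<in>A2_form M. AE z in M. T (\<lambda>x. \<omega> x + \<eta> x) z = T \<omega> z + T \<eta> z) \<and>
     (\<forall>a. \<forall>\<omega>\<in>A2_form M. AE z in M. T (\<lambda>x. a *s \<omega> x) z = a * T \<omega> z) \<and>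
     (\<exists>B. \<forall>\<omega>\<in>A2_form M. L2_norm M (T \<omega>) \<le> B * form_norm M \<omega>)"

definition canonical_solution_operator_bounded :: "(complex ^ 'n) measure \<Rightarrow> bool" where
  "canonical_solution_operator_bounded M \<longleftrightarrow>
     (\<exists>T. bounded_operator M T \<and>
          (\<forall>A a. finite A \<longrightarrow>
             (AE z in M. T (polynomial_form A a) z = canonical_solution_poly M A a z)))"

definition Gamma_set :: "(int ^ 'n) set" where
  "Gamma_set = {\<gamma>. (\<forall>j. \<gamma> $ j \<ge> -1) \<and> card {j. \<gamma> $ j = -1} \<le> 1}"

abbreviation unit_index :: "'n \<Rightarrow> int ^ 'n" where
  "unit_index p \<equiv> axis p 1"

definition c_coeff :: "(complex ^ 'n) measure \<Rightarrow> int ^ 'n \<Rightarrow> real" where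
  "c_coeff M \<gamma> =
     (if \<exists>j. \<gamma> $ j = -1 then 0
      else inverse (LINT z|M. (cmod (monomial (\<chi> j. nat (\<gamma> $ j)) z))\<^sup>2))"

end

theory Submission
  imports Defs
begin

text \<open>
  For \<open>\<alpha>\<close> and \<open>p\<close> let \<open>u\<^sub>\<alpha>\<^sub>,\<^sub>p\<close>, called \<open>residual p \<alpha>\<close> below, be the component of \<open>zbar\<^sub>p z\<^sup>\<alpha>\<close> orthogonal to \<open>A\<^sup>2(d\<mu>)\<close>, so that
  \<open>S(z\<^sup>\<alpha> dzbar\<^sub>p) = u\<^sub>\<alpha>\<^sub>,\<^sub>p\<close>. Since \<open>\<langle>zbar\<^sub>p z\<^sup>\<alpha>, z\<^sup>\<beta>\<rangle> = \<langle>z\<^sup>\<alpha>, z\<^sup>\<beta> z\<^sub>p\<rangle>\<close>, the only monomial that \<open>zbar\<^sub>p z\<^sup>\<alpha>\<close>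
  can meet is \<open>z\<^sup>\<beta>\<close> with \<open>\<beta> = \<alpha> - e\<^sub>p\<close>, and the projection has the coefficient \<open>c\<^sub>\<beta> / c\<^sub>\<alpha>\<close> there, which is
  \<open>0\<close> by convention if \<open>\<alpha>\<^sub>p = 0\<close>. The same computation shows two things
  (\<open>inner_residual\<close>): for fixed \<open>p\<close> the functions \<open>u\<^sub>\<alpha>\<^sub>,\<^sub>p\<close> are pairwise orthogonal, and
  \<open>\<parallel>u\<^sub>\<alpha>\<^sub>,\<^sub>p\<parallel>\<^sup>2 / \<parallel>z\<^sup>\<alpha>\<parallel>\<^sup>2 = c\<^sub>\<alpha> / c\<^sub>\<alpha>\<^sub>+\<^sub>e - c\<^sub>\<alpha>\<^sub>-\<^sub>e / c\<^sub>\<alpha>\<close> with \<open>e = e\<^sub>p\<close>. For \<open>\<gamma> = \<alpha> - e\<^sub>p\<close>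
  this is exactly the expression in the theorem (\<open>coefficient_gap\<close>). So the coefficient condition
  says that \<open>\<parallel>u\<^sub>\<alpha>\<^sub>,\<^sub>p\<parallel> \<le> K \<parallel>z\<^sup>\<alpha>\<parallel>\<close> for a constant \<open>K\<close> independent of \<open>\<alpha>\<close> and \<open>p\<close>
  (\<open>coefficient_condition_iff\<close>).

  If \<open>S\<close> is bounded, applying it to the single forms \<open>z\<^sup>\<alpha> dzbar\<^sub>p\<close> gives this bound. Conversely,
  \<open>S\<close> is the sum over \<open>p\<close> of the maps \<open>S\<^sub>p\<close> sending \<open>z\<^sup>\<alpha>\<close> to \<open>u\<^sub>\<alpha>\<^sub>,\<^sub>p\<close> and acting on the \<open>p\<close>-th component.
  Each \<open>S\<^sub>p\<close> maps an orthogonal family to an orthogonal family, so by Pythagoras the bound on the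
  family bounds \<open>S\<^sub>p\<close> on polynomials, and as there are only \<open>n\<close> summands the triangle inequality
  bounds \<open>S\<close>.

  The extension from polynomials to \<open>A\<^sup>2(d\<mu>)\<close> uses the completeness of \<open>L\<^sup>2\<close> (\<open>L2_complete\<close>). Elements of
  \<open>L\<^sup>2\<close> are functions here, and the extension is obtained by choosing a value from the closure of
  the graph (\<open>orthogonal_family_map\<close>).
\<close>

section \<open>The semi-inner product on square-integrable functions\<close>

lemma L2_I: "f \<in> borel_measurable M \<Longrightarrow> integrable M (\<lambda>z. (cmod (f z))\<^sup>2) \<Longrightarrow> f \<in> L2 M"
  by (simp add: L2_def)

lemma L2_measurable: "f \<in> L2 M \<Longrightarrow> f \<in> borel_measurable M"
  by (simp add: L2_def)

lemma L2_integrable: "f \<in> L2 M \<Longrightarrow> integrable M (\<lambda>z. (cmod (f z))\<^sup>2)"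
  by (simp add: L2_def)

lemma borel_measurable_cnj [measurable]: "cnj \<in> borel_measurable borel"
  by (intro borel_measurable_continuous_onI continuous_intros)

lemma L2_inner_integrable:
  assumes "f \<in> L2 M" "g \<in> L2 M"
  shows "integrable M (\<lambda>z. f z * cnj (g z))"
proof (rule Bochner_Integration.integrable_bound)
  show "integrable M (\<lambda>z. (cmod (f z))\<^sup>2 + (cmod (g z))\<^sup>2)"
    using assms by (simp add: L2_def)
  have [measurable]: "f \<in> borel_measurable M" "g \<in> borel_measurable M"
    using assms by (auto dest: L2_measurable)
  show "(\<lambda>z. f z * cnj (g z)) \<in> borel_measurable M"
    by measurable
  have "cmod (f z) * cmod (g z) \<le> (cmod (f z))\<^sup>2 + (cmod (g z))\<^sup>2" for z
  proof -
    have "0 \<le> cmod (f z) * cmod (g z)"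
      by simp
    then show ?thesis
      using sum_squares_bound[of "cmod (f z)" "cmod (g z)"] unfolding mult.assoc by linarith
  qed
  then show "AE z in M. norm (f z * cnj (g z)) \<le> norm ((cmod (f z))\<^sup>2 + (cmod (g z))\<^sup>2)"
    by (simp add: norm_mult)
qed

lemma L2_zero: "(\<lambda>_. 0) \<in> L2 M"
  by (simp add: L2_def)

lemma L2_scale:
  assumes "f \<in> L2 M"
  shows "(\<lambda>z. c * f z) \<in> L2 M"
  using assms by (auto simp: L2_def norm_mult power_mult_distrib)

lemma L2_add:
  assumes "f \<in> L2 M" "g \<in> L2 M"
  shows "(\<lambda>z. f z + g z) \<in> L2 M"
proof (rule L2_I)
  have [measurable]: "f \<in> borel_measurable M" "g \<in> borel_measurable M"
    using assms by (auto dest: L2_measurable)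
  show "(\<lambda>z. f z + g z) \<in> borel_measurable M"
    by measurable
  show "integrable M (\<lambda>z. (cmod (f z + g z))\<^sup>2)"
  proof (rule Bochner_Integration.integrable_bound)
    show "integrable M (\<lambda>z. 2 * (cmod (f z))\<^sup>2 + 2 * (cmod (g z))\<^sup>2)"
      using assms by (simp add: L2_def)
    have "(cmod (f z + g z))\<^sup>2 \<le> 2 * (cmod (f z))\<^sup>2 + 2 * (cmod (g z))\<^sup>2" for z
    proof -
      have "(cmod (f z + g z))\<^sup>2 \<le> (cmod (f z) + cmod (g z))\<^sup>2"
        by (intro power_mono norm_triangle_ineq) auto
      then show ?thesis
        using sum_squares_bound[of "cmod (f z)" "cmod (g z)"] by (simp add: power2_sum)
    qed
    then show "AE z in M. norm ((cmod (f z + g z))\<^sup>2)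
        \<le> norm (2 * (cmod (f z))\<^sup>2 + 2 * (cmod (g z))\<^sup>2)"
      by simp
  qed measurable
qed

lemma L2_diff:
  assumes "f \<in> L2 M" "g \<in> L2 M"
  shows "(\<lambda>z. f z - g z) \<in> L2 M"
  using L2_add[OF assms(1) L2_scale[OF assms(2), of "-1"]] by simp

lemma L2_sum: "(\<And>i. i \<in> A \<Longrightarrow> f i \<in> L2 M) \<Longrightarrow> (\<lambda>z. \<Sum>i\<in>A. f i z) \<in> L2 M"
  by (induction A rule: infinite_finite_induct) (auto simp: L2_zero L2_add)

lemma L2_inner_add_left:
  assumes "f \<in> L2 M" "g \<in> L2 M" "h \<in> L2 M"
  shows "L2_inner M (\<lambda>z. f z + g z) h = L2_inner M f h + L2_inner M g h"
  using assms by (simp add: L2_inner_def distrib_right L2_inner_integrable)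

lemma L2_inner_diff_left:
  assumes "f \<in> L2 M" "g \<in> L2 M" "h \<in> L2 M"
  shows "L2_inner M (\<lambda>z. f z - g z) h = L2_inner M f h - L2_inner M g h"
  using assms by (simp add: L2_inner_def left_diff_distrib L2_inner_integrable)

lemma L2_inner_scale_left: "L2_inner M (\<lambda>z. c * f z) h = c * L2_inner M f h"
  by (simp add: L2_inner_def mult.assoc)

lemma L2_inner_cnj: "cnj (L2_inner M f g) = L2_inner M g f"
proof -
  have "cnj (L2_inner M f g) = (LINT z|M. cnj (f z * cnj (g z)))"
    unfolding L2_inner_def by (rule Bochner_Integration.integral_cnj[symmetric])
  then show ?thesis
    by (simp add: L2_inner_def mult.commute)
qed

lemma L2_inner_sum_left:
  assumes "\<And>i. i \<in> A \<Longrightarrow> f i \<in> L2 M" "h \<in> L2 M"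
  shows "L2_inner M (\<lambda>z. \<Sum>i\<in>A. f i z) h = (\<Sum>i\<in>A. L2_inner M (f i) h)"
  using assms by (simp add: L2_inner_def sum_distrib_right L2_inner_integrable)

lemma L2_inner_diff_right:
  assumes "f \<in> L2 M" "g \<in> L2 M" "h \<in> L2 M"
  shows "L2_inner M h (\<lambda>z. f z - g z) = L2_inner M h f - L2_inner M h g"
  using L2_inner_diff_left[OF assms] L2_inner_cnj by (metis complex_cnj_diff)

lemma L2_inner_scale_right: "L2_inner M h (\<lambda>z. c * f z) = cnj c * L2_inner M h f"
  using L2_inner_scale_left L2_inner_cnj by (metis complex_cnj_mult)

lemma L2_inner_sum_right:
  assumes "\<And>i. i \<in> A \<Longrightarrow> f i \<in> L2 M" "h \<in> L2 M"
  shows "L2_inner M h (\<lambda>z. \<Sum>i\<in>A. f i z) = (\<Sum>i\<in>A. L2_inner M h (f i))"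
proof -
  have "L2_inner M h (\<lambda>z. \<Sum>i\<in>A. f i z) = cnj (L2_inner M (\<lambda>z. \<Sum>i\<in>A. f i z) h)"
    by (simp only: L2_inner_cnj)
  also have "\<dots> = (\<Sum>i\<in>A. L2_inner M h (f i))"
    by (simp only: L2_inner_sum_left[OF assms] cnj_sum L2_inner_cnj)
  finally show ?thesis .
qed

lemma L2_norm_nonneg [simp]: "0 \<le> L2_norm M f"
  by (simp add: L2_norm_def)

lemma L2_norm_sq: "(L2_norm M f)\<^sup>2 = (LINT z|M. (cmod (f z))\<^sup>2)"
  by (simp add: L2_norm_def)

lemma L2_inner_self: "L2_inner M f f = complex_of_real ((L2_norm M f)\<^sup>2)"
  by (simp add: L2_norm_sq L2_inner_def complex_norm_square[symmetric] del: of_real_power)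

lemma L2_norm_scale: "L2_norm M (\<lambda>z. c * f z) = cmod c * L2_norm M f"
  by (simp add: L2_norm_def norm_mult power_mult_distrib real_sqrt_mult)

lemma L2_norm_zero [simp]: "L2_norm M (\<lambda>_. 0) = 0"
  by (simp add: L2_norm_def)

lemma L2_norm_minus_commute: "L2_norm M (\<lambda>z. f z - g z) = L2_norm M (\<lambda>z. g z - f z)"
  by (simp add: L2_norm_def norm_minus_commute)

lemma L2_norm_eq_0_AE:
  assumes "f \<in> L2 M" "L2_norm M f = 0"
  shows "AE z in M. f z = 0"
proof -
  have "(LINT z|M. (cmod (f z))\<^sup>2) = 0"
    using assms(2) L2_norm_sq[of M f] by simp
  then show ?thesis
    using integral_nonneg_eq_0_iff_AE[OF L2_integrable[OF assms(1)]] by simp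
qed

lemma L2_norm_cong_AE:
  assumes "f \<in> L2 M" "g \<in> L2 M" "AE z in M. f z = g z"
  shows "L2_norm M f = L2_norm M g"
proof -
  have [measurable]: "f \<in> borel_measurable M" "g \<in> borel_measurable M"
    using assms by (auto dest: L2_measurable)
  have "(LINT z|M. (cmod (f z))\<^sup>2) = (LINT z|M. (cmod (g z))\<^sup>2)"
    by (rule integral_cong_AE) (use assms(3) in auto)
  then show ?thesis
    by (simp add: L2_norm_def)
qed

text \<open>
  The degenerate case, where one norm vanishes and the normalisation below would divide by zero,
  holds because the integrand vanishes almost everywhere.
\<close>

lemma L2_Cauchy_Schwarz:
  assumes f: "f \<in> L2 M" and g: "g \<in> L2 M"
  shows "cmod (L2_inner M f g) \<le> L2_norm M f * L2_norm M g"
proof (cases "L2_norm M f = 0 \<or> L2_norm M g = 0")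
  case True
  then have "AE z in M. f z * cnj (g z) = 0"
    using L2_norm_eq_0_AE[OF f] L2_norm_eq_0_AE[OF g] by (auto elim: eventually_mono)
  then have "L2_inner M f g = 0"
    unfolding L2_inner_def by (rule integral_eq_zero_AE)
  then show ?thesis
    by simp
next
  case False
  define s t where "s = L2_norm M f" and "t = L2_norm M g"
  have pos: "s > 0" "t > 0"
    using False L2_norm_nonneg[of M f] L2_norm_nonneg[of M g] by (auto simp: s_def t_def less_le)
  have sq: "s\<^sup>2 = (LINT z|M. (cmod (f z))\<^sup>2)" "t\<^sup>2 = (LINT z|M. (cmod (g z))\<^sup>2)"
    by (simp_all add: s_def t_def L2_norm_sq)
  (* the inequality between the geometric and the arithmetic mean, applied to f/s and g/t *)
  have pointwise: "cmod (f z * cnj (g z))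
      \<le> t / (2 * s) * (cmod (f z))\<^sup>2 + s / (2 * t) * (cmod (g z))\<^sup>2" for z
  proof -
    have "2 * (cmod (f z) / s) * (cmod (g z) / t) \<le> (cmod (f z) / s)\<^sup>2 + (cmod (g z) / t)\<^sup>2"
      by (rule sum_squares_bound)
    from mult_left_mono[OF this, of "s * t / 2"] pos
    have "s * t / 2 * (2 * (cmod (f z) / s) * (cmod (g z) / t))
        \<le> s * t / 2 * ((cmod (f z) / s)\<^sup>2 + (cmod (g z) / t)\<^sup>2)"
      by simp
    moreover have "s * t / 2 * (2 * (cmod (f z) / s) * (cmod (g z) / t)) = cmod (f z * cnj (g z))"
      using pos by (simp add: norm_mult)
    moreover have "s * t / 2 * ((cmod (f z) / s)\<^sup>2 + (cmod (g z) / t)\<^sup>2)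
        = t / (2 * s) * (cmod (f z))\<^sup>2 + s / (2 * t) * (cmod (g z))\<^sup>2"
      using pos by (simp add: power2_eq_square field_simps)
    ultimately show ?thesis
      by (simp only:)
  qed
  have "cmod (L2_inner M f g) \<le> (LINT z|M. cmod (f z * cnj (g z)))"
    unfolding L2_inner_def by (rule integral_norm_bound)
  also have "\<dots> \<le> (LINT z|M. t / (2 * s) * (cmod (f z))\<^sup>2 + s / (2 * t) * (cmod (g z))\<^sup>2)"
    by (intro integral_mono pointwise integrable_norm L2_inner_integrable f g
        Bochner_Integration.integrable_add integrable_mult_right L2_integrable)
  also have "\<dots> = t / (2 * s) * s\<^sup>2 + s / (2 * t) * t\<^sup>2"
    using L2_integrable[OF f] L2_integrable[OF g] by (simp add: sq)
  also have "\<dots> = s * t"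
    using pos by (simp add: power2_eq_square field_simps)
  finally show ?thesis
    by (simp add: s_def t_def)
qed

lemma L2_norm_add_le:
  assumes f: "f \<in> L2 M" and g: "g \<in> L2 M"
  shows "L2_norm M (\<lambda>z. f z + g z) \<le> L2_norm M f + L2_norm M g"
proof -
  let ?h = "\<lambda>z. f z + g z"
  have h: "?h \<in> L2 M"
    by (rule L2_add[OF f g])
  have "(L2_norm M ?h)\<^sup>2 = cmod (L2_inner M ?h ?h)"
    by (simp only: L2_inner_self norm_of_real abs_power2)
  also have "\<dots> \<le> cmod (L2_inner M f ?h) + cmod (L2_inner M g ?h)"
    unfolding L2_inner_add_left[OF f g h] by (rule norm_triangle_ineq)
  also have "\<dots> \<le> (L2_norm M f + L2_norm M g) * L2_norm M ?h"
    using L2_Cauchy_Schwarz[OF f h] L2_Cauchy_Schwarz[OF g h] by (simp add: distrib_right)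
  finally have "L2_norm M ?h * L2_norm M ?h \<le> (L2_norm M f + L2_norm M g) * L2_norm M ?h"
    by (simp add: power2_eq_square)
  then show ?thesis
    by (cases "L2_norm M ?h = 0") (auto simp: mult_le_cancel_right less_le)
qed

lemma L2_norm_diff_le:
  assumes "f \<in> L2 M" "g \<in> L2 M"
  shows "L2_norm M (\<lambda>z. f z - g z) \<le> L2_norm M f + L2_norm M g"
  using L2_norm_add_le[OF assms(1) L2_scale[OF assms(2), of "-1"]] L2_norm_scale[of M "-1" g]
  by simp

lemma L2_norm_sum_le:
  assumes "\<And>i. i \<in> A \<Longrightarrow> f i \<in> L2 M"
  shows "L2_norm M (\<lambda>z. \<Sum>i\<in>A. f i z) \<le> (\<Sum>i\<in>A. L2_norm M (f i))"
  using assms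
proof (induction A rule: infinite_finite_induct)
  case (insert i A)
  then have "L2_norm M (\<lambda>z. f i z + (\<Sum>i\<in>A. f i z))
      \<le> L2_norm M (f i) + L2_norm M (\<lambda>z. \<Sum>i\<in>A. f i z)"
    by (intro L2_norm_add_le L2_sum) auto
  with insert show ?case
    by simp
qed simp_all

lemma L2_norm_triangle_diff:
  assumes "f \<in> L2 M" "g \<in> L2 M" "h \<in> L2 M"
  shows "L2_norm M (\<lambda>z. f z - h z)
    \<le> L2_norm M (\<lambda>z. f z - g z) + L2_norm M (\<lambda>z. g z - h z)"
  using L2_norm_add_le[OF L2_diff[OF assms(1,2)] L2_diff[OF assms(2,3)]] by simp

lemma L2_Pythagoras:
  assumes u: "\<And>i. i \<in> A \<Longrightarrow> u i \<in> L2 M" and A: "finite A"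
    and orth: "\<And>i j. i \<in> A \<Longrightarrow> j \<in> A \<Longrightarrow> i \<noteq> j \<Longrightarrow> L2_inner M (u i) (u j) = 0"
  shows "(L2_norm M (\<lambda>z. \<Sum>i\<in>A. a i * u i z))\<^sup>2 = (\<Sum>i\<in>A. (cmod (a i))\<^sup>2 * (L2_norm M (u i))\<^sup>2)"
proof -
  let ?f = "\<lambda>z. \<Sum>i\<in>A. a i * u i z"
  have inner: "L2_inner M (\<lambda>z. a i * u i z) ?f = complex_of_real ((cmod (a i))\<^sup>2 * (L2_norm M (u i))\<^sup>2)"
    if i: "i \<in> A" for i
  proof -
    have "L2_inner M (\<lambda>z. a i * u i z) ?f = a i * (\<Sum>j\<in>A. cnj (a j) * L2_inner M (u i) (u j))"
      using i by (subst L2_inner_scale_left, subst L2_inner_sum_right)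
        (auto simp: L2_inner_scale_right intro: u L2_scale)
    also have "(\<Sum>j\<in>A. cnj (a j) * L2_inner M (u i) (u j))
        = (\<Sum>j\<in>A. if j = i then cnj (a i) * L2_inner M (u i) (u i) else 0)"
      by (intro sum.cong) (auto simp: orth i)
    also have "\<dots> = cnj (a i) * L2_inner M (u i) (u i)"
      using i A by simp
    finally show ?thesis
      by (simp add: L2_inner_self complex_norm_square[symmetric] mult.assoc[symmetric] del: of_real_power)
  qed
  have term_L2: "(\<lambda>z. a i * u i z) \<in> L2 M" if "i \<in> A" for i
    using that by (intro L2_scale u)
  have "complex_of_real ((L2_norm M ?f)\<^sup>2) = (\<Sum>i\<in>A. L2_inner M (\<lambda>z. a i * u i z) ?f)"
    unfolding L2_inner_self[symmetric] by (rule L2_inner_sum_left[OF term_L2 L2_sum[OF term_L2]])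
  also have "\<dots> = complex_of_real (\<Sum>i\<in>A. (cmod (a i))\<^sup>2 * (L2_norm M (u i))\<^sup>2)"
    by (simp add: inner)
  finally show ?thesis
    by (simp only: of_real_eq_iff)
qed

section \<open>Completeness\<close>

lemma nn_integral_L2_norm:
  assumes "f \<in> L2 M"
  shows "(\<integral>\<^sup>+z. ennreal ((cmod (f z))\<^sup>2) \<partial>M) = ennreal ((L2_norm M f)\<^sup>2)"
  unfolding L2_norm_sq by (rule nn_integral_eq_integral[OF L2_integrable[OF assms]]) simp

text \<open>
  Membership and norm bound are read off from the nonnegative integral because that is what Fatou's
  lemma controls, before the limit is known to be square integrable.
\<close>

lemma L2_norm_le_nn_integral:
  assumes meas: "f \<in> borel_measurable M" and B: "0 \<le> B"
    and le: "(\<integral>\<^sup>+z. ennreal ((cmod (f z))\<^sup>2) \<partial>M) \<le> ennreal (B\<^sup>2)"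
  shows "f \<in> L2 M" and "L2_norm M f \<le> B"
proof -
  have "(\<integral>\<^sup>+z. ennreal (norm ((cmod (f z))\<^sup>2)) \<partial>M) < \<infinity>"
    using le by (simp add: less_top[symmetric] top_unique) (metis ennreal_neq_top top_unique)
  then show f: "f \<in> L2 M"
    using meas by (intro L2_I integrableI_bounded) auto
  have "(L2_norm M f)\<^sup>2 \<le> B\<^sup>2"
    using le unfolding nn_integral_L2_norm[OF f] by (simp add: ennreal_le_iff)
  then show "L2_norm M f \<le> B"
    using B by (rule power2_le_imp_le)
qed

lemma sum_half_powers_le: "(\<Sum>k=m..<n. (1/2::real) ^ k) \<le> 2 * (1/2) ^ m"
proof -
  have "(\<Sum>k=m..<n. (1/2::real) ^ k) \<le> 2 * (1/2) ^ m - (if m \<le> n then 2 * (1/2) ^ n else 0)"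
    by (induction n) (auto simp: le_Suc_eq)
  then show ?thesis
    by (rule order_trans) auto
qed

lemma geometric_increments_tail:
  assumes L2: "\<And>k. f k \<in> L2 M"
    and step: "\<And>k. L2_norm M (\<lambda>z. f (Suc k) z - f k z) \<le> (1/2) ^ k"
    and "k \<le> m"
  shows "L2_norm M (\<lambda>z. f m z - f k z) \<le> 2 * (1/2) ^ k"
proof -
  have "(\<lambda>z. f m z - f k z) = (\<lambda>z. \<Sum>i=k..<m. f (Suc i) z - f i z)"
    using \<open>k \<le> m\<close> by (intro ext sum_Suc_diff'[symmetric])
  then have "L2_norm M (\<lambda>z. f m z - f k z) \<le> (\<Sum>i=k..<m. L2_norm M (\<lambda>z. f (Suc i) z - f i z))"
    using L2_norm_sum_le[of "{k..<m}" "\<lambda>i z. f (Suc i) z - f i z" M] L2 by (simp add: L2_diff)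
  also have "\<dots> \<le> (\<Sum>i=k..<m. (1/2) ^ i)"
    by (intro sum_mono step)
  also have "\<dots> \<le> 2 * (1/2) ^ k"
    by (rule sum_half_powers_le)
  finally show ?thesis .
qed

text \<open>
  The partial sums of \<open>\<Sum>\<^sub>k \<bar>f\<^sub>k\<^sub>+\<^sub>1 - f\<^sub>k\<bar>\<close> have norm at most \<open>2\<close>, so by monotone convergence the square of
  the full sum has a finite integral. The sum is therefore finite almost everywhere, and there the
  telescoping series of the \<open>f\<^sub>k\<^sub>+\<^sub>1 - f\<^sub>k\<close> converges absolutely.
\<close>

lemma geometric_increments_AE_convergent:
  assumes L2: "\<And>k. f k \<in> L2 M"
    and step: "\<And>k. L2_norm M (\<lambda>z. f (Suc k) z - f k z) \<le> (1/2) ^ k"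
  shows "AE z in M. convergent (\<lambda>k. f k z)"
proof -
  have [measurable]: "f k \<in> borel_measurable M" for k
    by (rule L2_measurable[OF L2])
  define G where "G N z = (\<Sum>k<N. cmod (f (Suc k) z - f k z))" for N z
  have [measurable]: "G N \<in> borel_measurable M" for N
    unfolding G_def by measurable
  have G_nonneg: "0 \<le> G N z" for N z
    by (simp add: G_def sum_nonneg)
  have G_mono: "G N z \<le> G N' z" if "N \<le> N'" for N N' z
    unfolding G_def by (rule sum_mono2) (use that in auto)
  have abs_L2: "(\<lambda>z. complex_of_real (cmod (f (Suc k) z - f k z))) \<in> L2 M" for k
    using L2_diff[OF L2[of "Suc k"] L2[of k]] by (auto simp: L2_def)
  have bound: "(\<integral>\<^sup>+z. ennreal ((G N z)\<^sup>2) \<partial>M) \<le> ennreal 4" for N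
  proof -
    let ?g = "\<lambda>z. \<Sum>k<N. complex_of_real (cmod (f (Suc k) z - f k z))"
    have g: "?g \<in> L2 M"
      by (intro L2_sum abs_L2)
    have "L2_norm M ?g \<le> (\<Sum>k<N. L2_norm M (\<lambda>z. complex_of_real (cmod (f (Suc k) z - f k z))))"
      by (intro L2_norm_sum_le abs_L2)
    also have "\<dots> = (\<Sum>k<N. L2_norm M (\<lambda>z. f (Suc k) z - f k z))"
      by (simp add: L2_norm_def)
    also have "\<dots> \<le> (\<Sum>k=0..<N. (1/2) ^ k)"
      unfolding lessThan_atLeast0 by (intro sum_mono step)
    also have "\<dots> \<le> 2"
      using sum_half_powers_le[of 0 N] by simp
    finally have le: "(L2_norm M ?g)\<^sup>2 \<le> 2\<^sup>2"
      by (intro power_mono) auto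
    have "cmod (?g z) = G N z" for z
      unfolding G_def of_real_sum[symmetric] norm_of_real by (simp add: sum_nonneg)
    then have "(\<integral>\<^sup>+z. ennreal ((G N z)\<^sup>2) \<partial>M) = ennreal ((L2_norm M ?g)\<^sup>2)"
      using nn_integral_L2_norm[OF g] by (simp only:)
    also have "\<dots> \<le> ennreal 4"
      using le by (intro ennreal_leI) simp
    finally show ?thesis .
  qed
  have "(\<integral>\<^sup>+z. (SUP N. ennreal ((G N z)\<^sup>2)) \<partial>M) = (SUP N. \<integral>\<^sup>+z. ennreal ((G N z)\<^sup>2) \<partial>M)"
    by (rule nn_integral_monotone_convergence_SUP)
      (auto intro!: ennreal_leI power_mono G_mono G_nonneg simp: incseq_def le_fun_def)
  also have "\<dots> \<le> ennreal 4"
    by (rule SUP_least) (rule bound)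
  finally have "(\<integral>\<^sup>+z. (SUP N. ennreal ((G N z)\<^sup>2)) \<partial>M) \<noteq> \<infinity>"
    by (auto simp: top_unique)
  then have "AE z in M. (SUP N. ennreal ((G N z)\<^sup>2)) \<noteq> \<infinity>"
    by (rule nn_integral_PInf_AE[rotated]) measurable
  then show ?thesis
  proof (rule eventually_mono)
    fix z
    assume fin: "(SUP N. ennreal ((G N z)\<^sup>2)) \<noteq> \<infinity>"
    obtain r where r: "0 \<le> r" "(SUP N. ennreal ((G N z)\<^sup>2)) = ennreal r"
      using fin by (cases "SUP N. ennreal ((G N z)\<^sup>2)") auto
    have "G N z \<le> sqrt r" for N
    proof -
      have "ennreal ((G N z)\<^sup>2) \<le> ennreal r"
        unfolding r(2)[symmetric] by (rule SUP_upper) simp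
      then show ?thesis
        using r(1) by (intro real_le_rsqrt) (simp add: ennreal_le_iff)
    qed
    then have "summable (\<lambda>k. cmod (f (Suc k) z - f k z))"
      by (intro summableI_nonneg_bounded[where x = "sqrt r"]) (auto simp: G_def)
    then have "summable (\<lambda>k. f (Suc k) z - f k z)"
      by (rule summable_norm_cancel)
    then have "convergent (\<lambda>n. \<Sum>k<n. f (Suc k) z - f k z)"
      by (simp add: summable_iff_convergent)
    then have "convergent (\<lambda>n. f n z - f 0 z)"
      by (simp only: sum_lessThan_telescope[of "\<lambda>k. f k z"])
    then show "convergent (\<lambda>k. f k z)"
      using convergent_add_const_right_iff[of "\<lambda>n. f n z" "- f 0 z"] by simp
  qed
qed

text \<open>
  The Riesz-Fischer theorem for sequences with geometrically small increments. The limit is the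
  pointwise one, and Fatou's lemma carries the bound on \<open>f\<^sub>m - f\<^sub>k\<close> over to it as \<open>m\<close> grows.
\<close>

theorem L2_complete:
  assumes L2: "\<And>k. f k \<in> L2 M"
    and step: "\<And>k. L2_norm M (\<lambda>z. f (Suc k) z - f k z) \<le> (1/2) ^ k"
  obtains g where "g \<in> L2 M" "\<And>k. L2_norm M (\<lambda>z. g z - f k z) \<le> 2 * (1/2) ^ k"
proof -
  have [measurable]: "f k \<in> borel_measurable M" for k
    by (rule L2_measurable[OF L2])
  define g where "g z = lim (\<lambda>k. f k z)" for z
  have [measurable]: "g \<in> borel_measurable M"
    unfolding g_def by measurable
  have conv: "AE z in M. (\<lambda>k. f k z) \<longlonglongrightarrow> g z"
    using geometric_increments_AE_convergent[OF L2 step]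
    by (auto elim!: eventually_mono simp: g_def convergent_LIMSEQ_iff)
  have "(\<integral>\<^sup>+z. ennreal ((cmod (g z - f k z))\<^sup>2) \<partial>M) \<le> ennreal ((2 * (1/2) ^ k)\<^sup>2)" for k
  proof -
    have "AE z in M. ennreal ((cmod (g z - f k z))\<^sup>2)
        = liminf (\<lambda>m. ennreal ((cmod (f m z - f k z))\<^sup>2))"
      using conv
    proof (rule eventually_mono)
      fix z
      assume "(\<lambda>k. f k z) \<longlonglongrightarrow> g z"
      then have "(\<lambda>m. ennreal ((cmod (f m z - f k z))\<^sup>2)) \<longlonglongrightarrow> ennreal ((cmod (g z - f k z))\<^sup>2)"
        by (intro tendsto_intros)
      then show "ennreal ((cmod (g z - f k z))\<^sup>2)
          = liminf (\<lambda>m. ennreal ((cmod (f m z - f k z))\<^sup>2))"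
        by (intro lim_imp_Liminf[symmetric]) auto
    qed
    then have "(\<integral>\<^sup>+z. ennreal ((cmod (g z - f k z))\<^sup>2) \<partial>M)
        = (\<integral>\<^sup>+z. liminf (\<lambda>m. ennreal ((cmod (f m z - f k z))\<^sup>2)) \<partial>M)"
      by (rule nn_integral_cong_AE)
    also have "\<dots> \<le> liminf (\<lambda>m. \<integral>\<^sup>+z. ennreal ((cmod (f m z - f k z))\<^sup>2) \<partial>M)"
      by (rule nn_integral_liminf) measurable
    also have "\<dots> \<le> liminf (\<lambda>m. ennreal ((2 * (1/2) ^ k)\<^sup>2))"
    proof (rule Liminf_mono)
      show "\<forall>\<^sub>F m in sequentially. (\<integral>\<^sup>+z. ennreal ((cmod (f m z - f k z))\<^sup>2) \<partial>M)
          \<le> ennreal ((2 * (1/2) ^ k)\<^sup>2)"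
        using eventually_ge_at_top[of k]
        by eventually_elim (auto simp only: nn_integral_L2_norm[OF L2_diff[OF L2 L2]]
            intro!: ennreal_leI power_mono geometric_increments_tail[OF L2 step] L2_norm_nonneg)
    qed
    finally show ?thesis
      by (simp add: Liminf_const)
  qed
  note close = L2_norm_le_nn_integral[OF _ _ this]
  have "(\<lambda>z. (g z - f 0 z) + f 0 z) \<in> L2 M"
    by (intro L2_add L2 close) auto
  with close(2) show thesis
    by (intro that[of g]) auto
qed

section \<open>Extending an operator from an orthogonal family\<close>

text \<open>
  The coefficients on the right do not involve \<open>x\<close>. So one merged combination serves a family and
  its image under a linear map at the same time, which makes the graph of the map closed under
  linear combinations.
\<close>

lemma linear_combination_merge:
  fixes a b x :: "'i \<Rightarrow> 'a :: comm_ring_1"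
  assumes "finite A" "finite B"
  shows "(\<Sum>i\<in>A. a i * x i) + c * (\<Sum>i\<in>B. b i * x i)
    = (\<Sum>i\<in>A \<union> B. ((if i \<in> A then a i else 0) + c * (if i \<in> B then b i else 0)) * x i)"
proof -
  have "(\<Sum>i\<in>A. a i * x i) = (\<Sum>i\<in>A \<union> B. (if i \<in> A then a i else 0) * x i)"
    by (rule sum.mono_neutral_cong_left) (use assms in auto)
  moreover have "(\<Sum>i\<in>B. b i * x i) = (\<Sum>i\<in>A \<union> B. (if i \<in> B then b i else 0) * x i)"
    by (rule sum.mono_neutral_cong_left) (use assms in auto)
  ultimately show ?thesis
    by (simp add: sum_distrib_left sum.distrib distrib_right mult.assoc)
qed

text \<open>
  The linear map \<open>e\<^sub>i \<mapsto> u\<^sub>i\<close> between the spans of two orthogonal families. Orthogonality of both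
  families is what makes the bound \<open>K\<close> on the individual vectors a bound for the map.
\<close>

locale orthogonal_family_map =
  fixes M :: "'a measure" and e u :: "'i \<Rightarrow> 'a \<Rightarrow> complex" and K :: real
  assumes e_L2: "\<And>i. e i \<in> L2 M" and u_L2: "\<And>i. u i \<in> L2 M"
    and e_orth: "\<And>i j. i \<noteq> j \<Longrightarrow> L2_inner M (e i) (e j) = 0"
    and u_orth: "\<And>i j. i \<noteq> j \<Longrightarrow> L2_inner M (u i) (u j) = 0"
    and K_nonneg: "0 \<le> K"
    and u_le: "\<And>i. L2_norm M (u i) \<le> K * L2_norm M (e i)"
begin

definition span_closure :: "('a \<Rightarrow> complex) set" where
  "span_closure = {f \<in> L2 M. \<forall>\<epsilon>>0. \<exists>A a. finite A \<and>
     L2_norm M (\<lambda>z. f z - (\<Sum>i\<in>A. a i * e i z)) < \<epsilon>}"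

text \<open>
  The closure of the graph. The same coefficients approximate \<open>f\<close> and \<open>g\<close>, so the definition
  does not rely on a unique representation of the elements of the span.
\<close>

definition closed_graph :: "('a \<Rightarrow> complex) \<Rightarrow> ('a \<Rightarrow> complex) \<Rightarrow> bool" where
  "closed_graph f g \<longleftrightarrow> f \<in> L2 M \<and> g \<in> L2 M \<and> (\<forall>\<epsilon>>0. \<exists>A a. finite A \<and>
     L2_norm M (\<lambda>z. f z - (\<Sum>i\<in>A. a i * e i z)) < \<epsilon> \<and>
     L2_norm M (\<lambda>z. g z - (\<Sum>i\<in>A. a i * u i z)) < \<epsilon>)"

definition extension :: "('a \<Rightarrow> complex) \<Rightarrow> 'a \<Rightarrow> complex" where
  "extension f = (SOME g. closed_graph f g)"

lemma comb_e_L2: "(\<lambda>z. \<Sum>i\<in>A. a i * e i z) \<in> L2 M"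
  by (intro L2_sum L2_scale e_L2)

lemma comb_u_L2: "(\<lambda>z. \<Sum>i\<in>A. a i * u i z) \<in> L2 M"
  by (intro L2_sum L2_scale u_L2)

lemma comb_norm_le:
  assumes "finite A"
  shows "L2_norm M (\<lambda>z. \<Sum>i\<in>A. a i * u i z) \<le> K * L2_norm M (\<lambda>z. \<Sum>i\<in>A. a i * e i z)"
proof (rule power2_le_imp_le)
  have "(L2_norm M (u i))\<^sup>2 \<le> K\<^sup>2 * (L2_norm M (e i))\<^sup>2" for i
    using power_mono[OF u_le[of i] L2_norm_nonneg, of 2] by (simp add: power_mult_distrib)
  then have "(\<Sum>i\<in>A. (cmod (a i))\<^sup>2 * (L2_norm M (u i))\<^sup>2)
      \<le> (\<Sum>i\<in>A. (cmod (a i))\<^sup>2 * (K\<^sup>2 * (L2_norm M (e i))\<^sup>2))"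
    by (intro sum_mono mult_left_mono) auto
  also have "\<dots> = K\<^sup>2 * (\<Sum>i\<in>A. (cmod (a i))\<^sup>2 * (L2_norm M (e i))\<^sup>2)"
    by (simp add: sum_distrib_left mult.left_commute)
  finally show "(L2_norm M (\<lambda>z. \<Sum>i\<in>A. a i * u i z))\<^sup>2
      \<le> (K * L2_norm M (\<lambda>z. \<Sum>i\<in>A. a i * e i z))\<^sup>2"
    by (simp add: power_mult_distrib L2_Pythagoras assms e_L2 u_L2 e_orth u_orth)
qed (simp add: K_nonneg)

lemma closed_graph_comb:
  assumes "finite A"
  shows "closed_graph (\<lambda>z. \<Sum>i\<in>A. a i * e i z) (\<lambda>z. \<Sum>i\<in>A. a i * u i z)"
  unfolding closed_graph_def
  by (intro conjI comb_e_L2 comb_u_L2 allI impI exI[of _ A] exI[of _ a]) (auto simp: assms)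

text \<open>
  Passes the estimate for finite combinations to the limit. With \<open>f = 0\<close> it also gives the
  single-valuedness of the closure, up to null sets.
\<close>

lemma closed_graph_bound:
  assumes "closed_graph f g"
  shows "L2_norm M g \<le> K * L2_norm M f"
proof (rule field_le_epsilon)
  fix \<epsilon> :: real
  assume "0 < \<epsilon>"
  define \<delta> where "\<delta> = \<epsilon> / (K + 1)"
  have \<delta>: "0 < \<delta>" "\<delta> + K * \<delta> = \<epsilon>"
  proof -
    have "(K + 1) * \<delta> = \<epsilon>"
      using K_nonneg by (simp add: \<delta>_def)
    then show "\<delta> + K * \<delta> = \<epsilon>"
      by (simp add: distrib_right)
    show "0 < \<delta>"
      using \<open>0 < \<epsilon>\<close> K_nonneg by (simp add: \<delta>_def)
  qed
  obtain A a where A: "finite A"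
    and f_close: "L2_norm M (\<lambda>z. f z - (\<Sum>i\<in>A. a i * e i z)) < \<delta>"
    and g_close: "L2_norm M (\<lambda>z. g z - (\<Sum>i\<in>A. a i * u i z)) < \<delta>"
    using assms \<delta>(1) unfolding closed_graph_def by blast
  have fg: "f \<in> L2 M" "g \<in> L2 M"
    using assms by (auto simp: closed_graph_def)
  have "L2_norm M g \<le> L2_norm M (\<lambda>z. g z - (\<Sum>i\<in>A. a i * u i z)) + L2_norm M (\<lambda>z. \<Sum>i\<in>A. a i * u i z)"
    using L2_norm_add_le[OF L2_diff[OF fg(2) comb_u_L2] comb_u_L2, of a A a A] by simp
  also have "\<dots> \<le> \<delta> + K * L2_norm M (\<lambda>z. \<Sum>i\<in>A. a i * e i z)"
    using g_close comb_norm_le[OF A, of a] by linarith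
  also have "L2_norm M (\<lambda>z. \<Sum>i\<in>A. a i * e i z) \<le> L2_norm M f + \<delta>"
    using L2_norm_diff_le[OF fg(1) L2_diff[OF fg(1) comb_e_L2], of a A] f_close by simp
  finally show "L2_norm M g \<le> K * L2_norm M f + \<epsilon>"
    using K_nonneg \<delta>(2) by (simp add: mult_left_mono distrib_left add.commute add.left_commute)
qed

lemma closed_graph_linear:
  assumes "closed_graph f g" "closed_graph f' g'"
  shows "closed_graph (\<lambda>z. f z + c * f' z) (\<lambda>z. g z + c * g' z)"
  unfolding closed_graph_def
proof (intro conjI allI impI)
  have L2: "f \<in> L2 M" "g \<in> L2 M" "f' \<in> L2 M" "g' \<in> L2 M"
    using assms by (auto simp: closed_graph_def)
  then show "(\<lambda>z. f z + c * f' z) \<in> L2 M" "(\<lambda>z. g z + c * g' z) \<in> L2 M"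
    by (auto intro: L2_add L2_scale)
  fix \<epsilon> :: real
  assume "0 < \<epsilon>"
  define \<delta> where "\<delta> = \<epsilon> / (cmod c + 1)"
  have \<delta>: "0 < \<delta>" "\<delta> + cmod c * \<delta> = \<epsilon>"
  proof -
    have "cmod c + 1 > 0"
      using norm_ge_zero[of c] by linarith
    then have "0 < \<delta>" "(cmod c + 1) * \<delta> = \<epsilon>"
      using \<open>0 < \<epsilon>\<close> by (simp_all add: \<delta>_def)
    then show "0 < \<delta>" "\<delta> + cmod c * \<delta> = \<epsilon>"
      by (simp_all add: distrib_right)
  qed
  obtain A a where A: "finite A"
    "L2_norm M (\<lambda>z. f z - (\<Sum>i\<in>A. a i * e i z)) < \<delta>"
    "L2_norm M (\<lambda>z. g z - (\<Sum>i\<in>A. a i * u i z)) < \<delta>"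
    using assms(1) \<delta>(1) unfolding closed_graph_def by blast
  obtain B b where B: "finite B"
    "L2_norm M (\<lambda>z. f' z - (\<Sum>i\<in>B. b i * e i z)) < \<delta>"
    "L2_norm M (\<lambda>z. g' z - (\<Sum>i\<in>B. b i * u i z)) < \<delta>"
    using assms(2) \<delta>(1) unfolding closed_graph_def by blast
  let ?d = "\<lambda>i. (if i \<in> A then a i else 0) + c * (if i \<in> B then b i else 0)"
  have combine: "L2_norm M (\<lambda>z. h z + c * h' z - (\<Sum>i\<in>A \<union> B. ?d i * x i z)) < \<epsilon>"
    if h: "h \<in> L2 M" "h' \<in> L2 M" and x: "\<And>i. x i \<in> L2 M"
      and close: "L2_norm M (\<lambda>z. h z - (\<Sum>i\<in>A. a i * x i z)) < \<delta>"
        "L2_norm M (\<lambda>z. h' z - (\<Sum>i\<in>B. b i * x i z)) < \<delta>" for h h' x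
  proof -
    have xL2: "(\<lambda>z. \<Sum>i\<in>C. d i * x i z) \<in> L2 M" for C d
      by (intro L2_sum L2_scale x)
    have "(\<lambda>z. h z + c * h' z - (\<Sum>i\<in>A \<union> B. ?d i * x i z))
        = (\<lambda>z. (h z - (\<Sum>i\<in>A. a i * x i z)) + c * (h' z - (\<Sum>i\<in>B. b i * x i z)))"
      by (simp only: linear_combination_merge[OF A(1) B(1), symmetric]) (simp add: algebra_simps)
    then have "L2_norm M (\<lambda>z. h z + c * h' z - (\<Sum>i\<in>A \<union> B. ?d i * x i z))
        \<le> L2_norm M (\<lambda>z. h z - (\<Sum>i\<in>A. a i * x i z))
          + cmod c * L2_norm M (\<lambda>z. h' z - (\<Sum>i\<in>B. b i * x i z))"
      using L2_norm_add_le[OF L2_diff[OF h(1) xL2] L2_scale[OF L2_diff[OF h(2) xL2]], of a A c b B]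
      by (simp only: L2_norm_scale)
    also have "\<dots> < \<delta> + cmod c * \<delta>"
      using close by (intro add_less_le_mono mult_left_mono) auto
    finally show ?thesis
      using \<delta>(2) by simp
  qed
  show "\<exists>C d. finite C \<and>
      L2_norm M (\<lambda>z. f z + c * f' z - (\<Sum>i\<in>C. d i * e i z)) < \<epsilon> \<and>
      L2_norm M (\<lambda>z. g z + c * g' z - (\<Sum>i\<in>C. d i * u i z)) < \<epsilon>"
    using A B by (intro exI[of _ "A \<union> B"] exI[of _ ?d] conjI combine L2 e_L2 u_L2) auto
qed

lemma closed_graph_unique:
  assumes "closed_graph f g" "closed_graph f h"
  shows "AE z in M. g z = h z"
proof -
  have graph: "closed_graph (\<lambda>z. 0) (\<lambda>z. g z - h z)"
    using closed_graph_linear[OF assms, of "-1"] by simp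
  then have "L2_norm M (\<lambda>z. g z - h z) \<le> 0"
    using closed_graph_bound by fastforce
  then have "L2_norm M (\<lambda>z. g z - h z) = 0"
    by (simp add: antisym)
  moreover have "(\<lambda>z. g z - h z) \<in> L2 M"
    using graph by (simp add: closed_graph_def)
  ultimately show ?thesis
    using L2_norm_eq_0_AE by fastforce
qed

text \<open>
  If combinations approach \<open>f\<close> with geometric speed, the bound of the map makes their images a
  sequence with geometrically small increments, and completeness supplies its limit.
\<close>

lemma closed_graph_total:
  assumes f: "f \<in> span_closure"
  obtains g where "closed_graph f g"
proof -
  have fL2: "f \<in> L2 M"
    using f by (simp add: span_closure_def)
  (* this factor absorbs K; K + 1 avoids dividing by zero when K = 0 *)
  define r where "r = 1 / (K + 1)"
  have r: "0 < r" "r \<le> 1" "K * r \<le> 1"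
    using K_nonneg by (simp_all add: r_def)
  define \<delta> where "\<delta> k = r * (1/2) ^ Suc k" for k :: nat
  have \<delta>_pos: "0 < \<delta> k" for k
    using r(1) by (simp add: \<delta>_def)
  have "\<exists>A a. finite A \<and> L2_norm M (\<lambda>z. f z - (\<Sum>i\<in>A. a i * e i z)) < \<delta> k" for k
    using f \<delta>_pos[of k] by (auto simp: span_closure_def)
  then obtain A a where A: "\<And>k. finite (A k)"
    and close: "\<And>k. L2_norm M (\<lambda>z. f z - (\<Sum>i\<in>A k. a k i * e i z)) < \<delta> k"
    by metis
  let ?E = "\<lambda>k z. \<Sum>i\<in>A k. a k i * e i z" and ?U = "\<lambda>k z. \<Sum>i\<in>A k. a k i * u i z"
  have step: "L2_norm M (\<lambda>z. ?U (Suc k) z - ?U k z) \<le> (1/2) ^ k" for k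
  proof -
    have "closed_graph (\<lambda>z. ?E (Suc k) z + (-1) * ?E k z) (\<lambda>z. ?U (Suc k) z + (-1) * ?U k z)"
      by (intro closed_graph_linear closed_graph_comb A)
    then have "L2_norm M (\<lambda>z. ?U (Suc k) z - ?U k z) \<le> K * L2_norm M (\<lambda>z. ?E (Suc k) z - ?E k z)"
      using closed_graph_bound by fastforce
    also have "L2_norm M (\<lambda>z. ?E (Suc k) z - ?E k z) \<le> \<delta> (Suc k) + \<delta> k"
      using L2_norm_triangle_diff[OF comb_e_L2[where A = "A (Suc k)" and a = "a (Suc k)"] fL2
          comb_e_L2[where A = "A k" and a = "a k"]]
        close[of k] close[of "Suc k"] L2_norm_minus_commute[of M f "?E (Suc k)"] by linarith
    also have "\<delta> (Suc k) + \<delta> k \<le> r * (1/2) ^ k"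
      using r(1) by (simp add: \<delta>_def)
    also have "K * (r * (1/2) ^ k) \<le> (1/2) ^ k"
      using mult_right_mono[OF r(3), of "(1/2) ^ k"] by (simp add: mult.assoc)
    finally show ?thesis
      using K_nonneg by (simp add: mult_left_mono)
  qed
  obtain g where g: "g \<in> L2 M" and g_close: "\<And>k. L2_norm M (\<lambda>z. g z - ?U k z) \<le> 2 * (1/2) ^ k"
    using L2_complete[OF comb_u_L2 step] by blast
  have "closed_graph f g"
    unfolding closed_graph_def
  proof (intro conjI allI impI fL2 g)
    fix \<epsilon> :: real
    assume "0 < \<epsilon>"
    then obtain k where k: "(1/2) ^ k < \<epsilon> / 2"
      using real_arch_pow_inv[of "\<epsilon> / 2" "1/2"] by auto
    have "\<delta> k \<le> (1/2) ^ k"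
      using mult_right_mono[OF r(2), of "(1/2) ^ k"] r(1) by (simp add: \<delta>_def)
    with k close[of k] \<open>0 < \<epsilon>\<close> have "L2_norm M (\<lambda>z. f z - ?E k z) < \<epsilon>"
      by linarith
    moreover have "L2_norm M (\<lambda>z. g z - ?U k z) < \<epsilon>"
      using k g_close[of k] by linarith
    ultimately show "\<exists>A a. finite A \<and> L2_norm M (\<lambda>z. f z - (\<Sum>i\<in>A. a i * e i z)) < \<epsilon> \<and>
        L2_norm M (\<lambda>z. g z - (\<Sum>i\<in>A. a i * u i z)) < \<epsilon>"
      using A by blast
  qed
  then show thesis
    by (rule that)
qed

lemma closed_graph_extension:
  assumes "closed_graph f g"
  shows "closed_graph f (extension f)"
  unfolding extension_def by (rule someI[of "closed_graph f", OF assms])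

lemma closed_graph_extension_closure:
  assumes "f \<in> span_closure"
  shows "closed_graph f (extension f)"
  using closed_graph_total[OF assms] closed_graph_extension by blast

lemma extension_L2:
  assumes "f \<in> span_closure"
  shows "extension f \<in> L2 M"
  using closed_graph_extension_closure[OF assms] by (simp add: closed_graph_def)

lemma extension_bound:
  assumes "f \<in> span_closure"
  shows "L2_norm M (extension f) \<le> K * L2_norm M f"
  using closed_graph_extension_closure[OF assms] by (rule closed_graph_bound)

lemma extension_linear:
  assumes "f \<in> span_closure" "g \<in> span_closure"
  shows "AE z in M. extension (\<lambda>x. f x + c * g x) z = extension f z + c * extension g z"
proof -
  have "closed_graph (\<lambda>x. f x + c * g x) (\<lambda>x. extension f x + c * extension g x)"
    by (intro closed_graph_linear closed_graph_extension_closure assms)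
  then show ?thesis
    using closed_graph_extension closed_graph_unique by blast
qed

lemma extension_comb:
  assumes "finite A"
  shows "AE z in M. extension (\<lambda>x. \<Sum>i\<in>A. a i * e i x) z = (\<Sum>i\<in>A. a i * u i z)"
  using closed_graph_comb[OF assms] closed_graph_extension closed_graph_unique by blast

end

section \<open>Orthogonal monomials and the residuals of \<open>zbar\<^sub>p z\<^sup>\<alpha>\<close>\<close>

(* keeps the multiindex axis p 1 from being rewritten to axis p (Suc 0) *)
declare One_nat_def [simp del]

lemma monomial_add: "monomial (\<alpha> + \<beta>) z = monomial \<alpha> z * monomial \<beta> z"
  by (simp add: monomial_def power_add prod.distrib)

lemma monomial_axis: "monomial (axis p 1) z = z $ p"
proof -
  have "monomial (axis p 1) z = (\<Prod>j\<in>UNIV. if j = p then z $ j else 1)"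
    unfolding monomial_def by (intro prod.cong) (auto simp: axis_def)
  then show ?thesis
    by simp
qed

lemma diff_axis_add:
  fixes \<alpha> :: "nat ^ 'n"
  assumes "\<alpha> $ p \<noteq> 0"
  shows "\<alpha> - axis p 1 + axis p 1 = \<alpha>"
  using assms by (auto simp: vec_eq_iff axis_def)

lemma continuous_monomial: "continuous_on UNIV (monomial \<alpha>)"
proof -
  have "monomial \<alpha> = (\<lambda>z. \<Prod>j\<in>UNIV. (z $ j) ^ (\<alpha> $ j))"
    by (simp add: monomial_def fun_eq_iff)
  then show ?thesis
    by (simp only:) (intro continuous_intros)
qed

lemma A2_diff:
  assumes f: "f \<in> A2 M" and g: "g \<in> A2 M"
    and poly: "polynomials \<subseteq> L2 M"
  shows "(\<lambda>z. f z - g z) \<in> A2 M"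
  unfolding A2_def
proof (intro CollectI conjI allI impI)
  have L2: "f \<in> L2 M" "g \<in> L2 M"
    using f g by (auto simp: A2_def)
  then show "(\<lambda>z. f z - g z) \<in> L2 M"
    by (rule L2_diff)
  fix e :: real
  assume "0 < e"
  then have "0 < e / 2"
    by simp
  obtain p where p: "p \<in> polynomials" "L2_norm M (\<lambda>z. f z - p z) < e / 2"
    using f \<open>0 < e / 2\<close> unfolding A2_def by blast
  obtain q where q: "q \<in> polynomials" "L2_norm M (\<lambda>z. g z - q z) < e / 2"
    using g \<open>0 < e / 2\<close> unfolding A2_def by blast
  obtain A a B b where A: "finite A" "p = (\<lambda>z. \<Sum>\<alpha>\<in>A. a \<alpha> * monomial \<alpha> z)"
    and B: "finite B" "q = (\<lambda>z. \<Sum>\<alpha>\<in>B. b \<alpha> * monomial \<alpha> z)"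
    using p(1) q(1) by (auto simp: polynomials_def)
  have "(\<lambda>z. p z - q z) = (\<lambda>z. p z + (-1) * q z)"
    by simp
  also have "\<dots> \<in> polynomials"
    unfolding A(2) B(2) linear_combination_merge[OF A(1) B(1)] polynomials_def
    by (rule CollectI, rule exI[of _ "A \<union> B"],
        rule exI[of _ "\<lambda>\<alpha>. (if \<alpha> \<in> A then a \<alpha> else 0) + (-1) * (if \<alpha> \<in> B then b \<alpha> else 0)"])
      (simp add: A(1) B(1))
  finally have "(\<lambda>z. p z - q z) \<in> polynomials" .
  moreover have "L2_norm M (\<lambda>z. f z - g z - (p z - q z)) < e"
  proof -
    have "p \<in> L2 M" "q \<in> L2 M"
      using p(1) q(1) poly by auto
    then have "L2_norm M (\<lambda>z. (f z - p z) - (g z - q z))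
        \<le> L2_norm M (\<lambda>z. f z - p z) + L2_norm M (\<lambda>z. g z - q z)"
      using L2 by (intro L2_norm_diff_le L2_diff)
    with p(2) q(2) show ?thesis
      by (simp add: algebra_simps)
  qed
  ultimately show "\<exists>r\<in>polynomials. L2_norm M (\<lambda>z. f z - g z - r z) < e"
    by (intro bexI[of _ "\<lambda>z. p z - q z"])
qed

locale orthogonal_monomials =
  fixes M :: "(complex ^ 'n) measure"
  assumes borel: "sets M = sets borel"
    and orthogonal: "\<And>\<alpha> \<beta>. \<alpha> \<noteq> \<beta> \<Longrightarrow> L2_inner M (monomial \<alpha>) (monomial \<beta>) = 0"
    and finite_norm: "\<And>\<alpha>. integrable M (\<lambda>z. (cmod (monomial \<alpha> z))\<^sup>2)"
    and positive_norm: "\<And>\<alpha>. 0 < (LINT z|M. (cmod (monomial \<alpha> z))\<^sup>2)"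
begin

abbreviation mnorm :: "nat ^ 'n \<Rightarrow> real" where
  "mnorm \<alpha> \<equiv> L2_norm M (monomial \<alpha>)"

lemma mnorm_pos: "0 < mnorm \<alpha>"
  using positive_norm[of \<alpha>] by (simp add: L2_norm_def)

lemma monomial_L2: "monomial \<alpha> \<in> L2 M"
proof (rule L2_I[OF _ finite_norm])
  show "monomial \<alpha> \<in> borel_measurable M"
    using borel_measurable_continuous_onI[OF continuous_monomial] measurable_cong_sets[OF borel refl]
    by blast
qed

lemma polynomials_L2: "polynomials \<subseteq> L2 M"
  by (auto simp: polynomials_def intro!: L2_sum L2_scale monomial_L2)

lemma scaled_monomial_A2: "(\<lambda>z. c * monomial \<alpha> z) \<in> A2 M"
proof -
  have poly: "(\<lambda>z. c * monomial \<alpha> z) \<in> polynomials"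
    unfolding polynomials_def by (intro CollectI exI[of _ "{\<alpha>}"] exI[of _ "\<lambda>_. c"]) simp
  show ?thesis
    unfolding A2_def
    by (intro CollectI conjI L2_scale monomial_L2 allI impI bexI[OF _ poly]) simp
qed

text \<open>
  By Cauchy-Schwarz \<open>\<langle>h, g\<rangle>\<close> differs from \<open>\<langle>h, q\<rangle> = 0\<close> by at most \<open>\<parallel>h\<parallel> \<parallel>g - q\<parallel>\<close> for every polynomial \<open>q\<close>.
\<close>

lemma orthogonal_A2:
  assumes h: "h \<in> L2 M" and orth: "\<And>\<alpha>. L2_inner M h (monomial \<alpha>) = 0" and g: "g \<in> A2 M"
  shows "L2_inner M h g = 0"
proof (rule ccontr)
  assume "L2_inner M h g \<noteq> 0"
  define \<epsilon> where "\<epsilon> = cmod (L2_inner M h g) / (L2_norm M h + 1)"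
  have pos: "0 < L2_norm M h + 1"
    by (simp add: add_nonneg_pos)
  then have "0 < \<epsilon>"
    using \<open>L2_inner M h g \<noteq> 0\<close> by (simp add: \<epsilon>_def)
  then obtain p where p: "p \<in> polynomials" "L2_norm M (\<lambda>z. g z - p z) < \<epsilon>"
    using g by (auto simp: A2_def)
  have L2: "p \<in> L2 M" "g \<in> L2 M"
    using p(1) polynomials_L2 g by (auto simp: A2_def)
  obtain A a where "finite A" "p = (\<lambda>z. \<Sum>\<alpha>\<in>A. a \<alpha> * monomial \<alpha> z)"
    using p(1) by (auto simp: polynomials_def)
  then have "L2_inner M h p = 0"
    by (simp add: L2_inner_sum_right h L2_scale monomial_L2 L2_inner_scale_right orth)
  then have "cmod (L2_inner M h g) = cmod (L2_inner M h (\<lambda>z. g z - p z))"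
    by (simp add: L2_inner_diff_right h L2)
  also have "\<dots> \<le> L2_norm M h * L2_norm M (\<lambda>z. g z - p z)"
    by (intro L2_Cauchy_Schwarz h L2_diff L2)
  also have "\<dots> \<le> L2_norm M h * \<epsilon>"
    using p(2) by (intro mult_left_mono) auto
  also have "\<dots> < (L2_norm M h + 1) * \<epsilon>"
    using \<open>0 < \<epsilon>\<close> by simp
  also have "\<dots> = cmod (L2_inner M h g)"
    using pos by (simp add: \<epsilon>_def)
  finally show False
    by simp
qed

text \<open>
  The coefficient at \<open>z\<^sup>\<beta>\<close>, \<open>\<beta> = \<alpha> - e\<^sub>p\<close>, of the projection of \<open>zbar\<^sub>p z\<^sup>\<alpha>\<close> to \<open>A\<^sup>2(d\<mu>)\<close>. For \<open>\<alpha>\<^sub>p = 0\<close> the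
  truncated difference \<open>\<alpha> - e\<^sub>p\<close> equals \<open>\<alpha>\<close>, and the coefficient \<open>0\<close> removes the spurious term.
\<close>

definition lowering_coeff :: "'n \<Rightarrow> nat ^ 'n \<Rightarrow> real" where
  "lowering_coeff p \<alpha> = (if \<alpha> $ p = 0 then 0 else (mnorm \<alpha>)\<^sup>2 / (mnorm (\<alpha> - axis p 1))\<^sup>2)"

definition residual :: "'n \<Rightarrow> nat ^ 'n \<Rightarrow> complex ^ 'n \<Rightarrow> complex" where
  "residual p \<alpha> z = cnj (z $ p) * monomial \<alpha> z
     - complex_of_real (lowering_coeff p \<alpha>) * monomial (\<alpha> - axis p 1) z"

lemma cnj_monomial_L2: "(\<lambda>z. cnj (z $ p) * monomial \<alpha> z) \<in> L2 M"
proof -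
  have "(\<lambda>z. cmod (cnj (z $ p) * monomial \<alpha> z)) = (\<lambda>z. cmod (monomial (\<alpha> + axis p 1) z))"
    by (simp add: monomial_add monomial_axis norm_mult mult.commute)
  moreover have "(\<lambda>z :: complex ^ 'n. cnj (z $ p)) \<in> borel_measurable M"
    unfolding measurable_cong_sets[OF borel refl]
    by (intro borel_measurable_continuous_onI continuous_intros)
  ultimately show ?thesis
    using L2_measurable[OF monomial_L2[of \<alpha>]] L2_integrable[OF monomial_L2[of "\<alpha> + axis p 1"]]
    by (intro L2_I borel_measurable_times) (simp_all add: fun_eq_iff)
qed

lemma residual_L2: "residual p \<alpha> \<in> L2 M"
  unfolding residual_def by (intro L2_diff L2_scale cnj_monomial_L2 monomial_L2)

lemma inner_cnj_left:
  "L2_inner M (\<lambda>z. cnj (z $ p) * monomial \<alpha> z) (monomial \<beta>)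
    = L2_inner M (monomial \<alpha>) (monomial (\<beta> + axis p 1))"
  by (simp add: L2_inner_def monomial_add monomial_axis mult_ac)

text \<open>
  With \<open>inner_cnj_left\<close> this says that \<open>zbar\<^sub>p z\<^sup>\<alpha>\<close> and its lowered monomial have the same inner product
  with every \<open>z\<^sup>\<beta>\<close>: both are \<open>\<parallel>z\<^sup>\<alpha>\<parallel>\<^sup>2\<close> if \<open>\<alpha> = \<beta> + e\<^sub>p\<close>, and both vanish otherwise.
\<close>

lemma inner_lowering:
  "lowering_coeff p \<alpha> * L2_inner M (monomial (\<alpha> - axis p 1)) (monomial \<beta>)
    = L2_inner M (monomial \<alpha>) (monomial (\<beta> + axis p 1))"
proof (cases "\<alpha> = \<beta> + axis p 1")
  case True
  then have "\<alpha> $ p \<noteq> 0" "\<alpha> - axis p 1 = \<beta>"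
    by (auto simp: vec_eq_iff)
  then show ?thesis
    using mnorm_pos[of \<beta>] True by (simp add: lowering_coeff_def L2_inner_self)
next
  case False
  then have "\<alpha> $ p = 0 \<or> \<alpha> - axis p 1 \<noteq> \<beta>"
    using diff_axis_add[of \<alpha> p] by auto
  then show ?thesis
    using False by (auto simp: lowering_coeff_def orthogonal)
qed

lemma residual_orthogonal_monomial: "L2_inner M (residual p \<alpha>) (monomial \<beta>) = 0"
  unfolding residual_def
  by (subst L2_inner_diff_left)
    (simp_all add: cnj_monomial_L2 L2_scale monomial_L2 inner_cnj_left L2_inner_scale_left
      inner_lowering)

lemma residual_orthogonal_A2: "g \<in> A2 M \<Longrightarrow> L2_inner M (residual p \<alpha>) g = 0"
  by (rule orthogonal_A2[OF residual_L2 residual_orthogonal_monomial])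

text \<open>
  The first residual is orthogonal to \<open>A\<^sup>2(d\<mu>)\<close>. So the second one may be replaced by \<open>zbar\<^sub>p z\<^sup>\<beta>\<close>, from which it differs by an element of \<open>A\<^sup>2(d\<mu>)\<close>.
  In what remains the factors \<open>zbar\<^sub>p\<close> and \<open>z\<^sub>p\<close> can be moved across the inner product.
\<close>

lemma inner_residual:
  "L2_inner M (residual p \<alpha>) (residual p \<beta>)
    = L2_inner M (monomial (\<alpha> + axis p 1)) (monomial (\<beta> + axis p 1))
      - lowering_coeff p \<alpha> * L2_inner M (monomial \<alpha>) (monomial \<beta>)"
proof -
  let ?h = "\<lambda>z. cnj (z $ p) * monomial \<beta> z"
  (* multiplication by z_p undoes the lowering *)
  have lower: "complex_of_real (lowering_coeff p \<alpha>) * (z $ p * monomial (\<alpha> - axis p 1) z)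
      = lowering_coeff p \<alpha> * monomial \<alpha> z" for z
  proof (cases "\<alpha> $ p = 0")
    case False
    then have "z $ p * monomial (\<alpha> - axis p 1) z = monomial \<alpha> z"
      using monomial_add[of "\<alpha> - axis p 1" "axis p 1" z] diff_axis_add[of \<alpha> p]
      by (simp add: monomial_axis mult.commute)
    then show ?thesis
      by simp
  qed (simp add: lowering_coeff_def)
  have "L2_inner M (residual p \<alpha>) (residual p \<beta>) = L2_inner M (residual p \<alpha>) ?h"
    unfolding residual_def[of p \<beta>, abs_def]
    by (subst L2_inner_diff_right)
      (simp_all add: cnj_monomial_L2 L2_scale monomial_L2 residual_L2 L2_inner_scale_right
        residual_orthogonal_monomial)
  also have "\<dots> = L2_inner M (\<lambda>z. cnj (z $ p) * monomial \<alpha> z) ?h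
      - L2_inner M (\<lambda>z. lowering_coeff p \<alpha> * monomial (\<alpha> - axis p 1) z) ?h"
    unfolding residual_def[of p \<alpha>, abs_def]
    by (rule L2_inner_diff_left) (intro cnj_monomial_L2 L2_scale monomial_L2)+
  also have "L2_inner M (\<lambda>z. cnj (z $ p) * monomial \<alpha> z) ?h
      = L2_inner M (monomial (\<alpha> + axis p 1)) (monomial (\<beta> + axis p 1))"
    by (simp add: L2_inner_def monomial_add monomial_axis mult_ac)
  also have "L2_inner M (\<lambda>z. lowering_coeff p \<alpha> * monomial (\<alpha> - axis p 1) z) ?h
      = L2_inner M (\<lambda>z. lowering_coeff p \<alpha> * (z $ p * monomial (\<alpha> - axis p 1) z)) (monomial \<beta>)"
    by (simp add: L2_inner_def mult_ac)
  also have "\<dots> = lowering_coeff p \<alpha> * L2_inner M (monomial \<alpha>) (monomial \<beta>)"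
    unfolding lower by (rule L2_inner_scale_left)
  finally show ?thesis .
qed

lemma residual_orthogonal: "\<alpha> \<noteq> \<beta> \<Longrightarrow> L2_inner M (residual p \<alpha>) (residual p \<beta>) = 0"
  by (simp add: inner_residual orthogonal)

lemma residual_norm_sq:
  "(L2_norm M (residual p \<alpha>))\<^sup>2 = (mnorm (\<alpha> + axis p 1))\<^sup>2 - lowering_coeff p \<alpha> * (mnorm \<alpha>)\<^sup>2"
proof -
  have "complex_of_real ((L2_norm M (residual p \<alpha>))\<^sup>2)
      = complex_of_real ((mnorm (\<alpha> + axis p 1))\<^sup>2 - lowering_coeff p \<alpha> * (mnorm \<alpha>)\<^sup>2)"
    using inner_residual[of p \<alpha> \<alpha>] unfolding L2_inner_self by simp
  then show ?thesis
    by (simp only: of_real_eq_iff)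
qed

text \<open>
  The residual is one admissible choice. Two choices differ by an element of \<open>A\<^sup>2(d\<mu>)\<close> that is
  orthogonal to \<open>A\<^sup>2(d\<mu>)\<close>, hence to itself, so they agree almost everywhere.
\<close>

lemma canonical_solution_residual:
  shows "canonical_solution M \<alpha> p \<in> L2 M"
    and "AE z in M. canonical_solution M \<alpha> p z = residual p \<alpha> z"
proof -
  let ?P = "\<lambda>u. u \<in> L2 M \<and> (\<lambda>z. u z - cnj (z $ p) * monomial \<alpha> z) \<in> A2 M \<and>
    (\<forall>g\<in>A2 M. L2_inner M u g = 0)"
  have diff_A2: "(\<lambda>z. residual p \<alpha> z - cnj (z $ p) * monomial \<alpha> z) \<in> A2 M"
    using scaled_monomial_A2[of "- complex_of_real (lowering_coeff p \<alpha>)" "\<alpha> - axis p 1"]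
    by (simp add: residual_def)
  then have "?P (residual p \<alpha>)"
    by (simp add: residual_L2 residual_orthogonal_A2)
  then have u: "?P (canonical_solution M \<alpha> p)"
    unfolding canonical_solution_def by (rule someI[of ?P])
  then show L2: "canonical_solution M \<alpha> p \<in> L2 M"
    by simp
  let ?d = "\<lambda>z. canonical_solution M \<alpha> p z - residual p \<alpha> z"
  have "?d \<in> A2 M"
    using A2_diff[OF _ diff_A2 polynomials_L2, of "\<lambda>z. canonical_solution M \<alpha> p z - cnj (z $ p) * monomial \<alpha> z"]
      u by simp
  then have "L2_inner M ?d ?d = 0"
    using u by (subst L2_inner_diff_left) (auto simp: residual_L2 residual_orthogonal_A2 A2_def)
  then have "L2_norm M ?d = 0"
    by (simp add: L2_inner_self)
  then have "AE z in M. ?d z = 0"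
    by (intro L2_norm_eq_0_AE L2_diff L2 residual_L2)
  then show "AE z in M. canonical_solution M \<alpha> p z = residual p \<alpha> z"
    by simp
qed

section \<open>The coefficient condition\<close>

lemma c_coeff_of_nat: "c_coeff M (\<chi> j. int (\<alpha> $ j)) = inverse ((mnorm \<alpha>)\<^sup>2)"
  by (simp add: c_coeff_def L2_norm_sq)

text \<open>
  The boundary case \<open>\<alpha>\<^sub>p = 0\<close> is the one with \<open>\<gamma>\<^sub>p = -1\<close>, where the convention \<open>c\<^sub>\<gamma> = 0\<close> matches the
  vanishing projection of \<open>zbar\<^sub>p z\<^sup>\<alpha>\<close>.
\<close>

lemma coefficient_gap:
  fixes \<alpha> :: "nat ^ 'n" and p :: 'n
  defines "\<gamma> \<equiv> (\<chi> j. int (\<alpha> $ j)) - unit_index p"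
  shows "c_coeff M (\<gamma> + unit_index p) / c_coeff M (\<gamma> + 2 *s unit_index p)
      - c_coeff M \<gamma> / c_coeff M (\<gamma> + unit_index p)
    = (L2_norm M (residual p \<alpha>) / mnorm \<alpha>)\<^sup>2"
proof -
  have 1: "\<gamma> + unit_index p = (\<chi> j. int (\<alpha> $ j))"
    by (simp add: \<gamma>_def)
  have 2: "\<gamma> + 2 *s unit_index p = (\<chi> j. int ((\<alpha> + axis p 1) $ j))"
    by (auto simp: \<gamma>_def vec_eq_iff axis_def)
  have 3: "c_coeff M \<gamma> / c_coeff M (\<gamma> + unit_index p) = lowering_coeff p \<alpha>"
  proof (cases "\<alpha> $ p = 0")
    case True
    then have "\<gamma> $ p = -1"
      by (simp add: \<gamma>_def)
    then show ?thesis
      using True by (auto simp: c_coeff_def lowering_coeff_def)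
  next
    case False
    then have "\<gamma> = (\<chi> j. int ((\<alpha> - axis p 1) $ j))"
      by (auto simp: \<gamma>_def vec_eq_iff axis_def)
    then show ?thesis
      using False unfolding 1 by (simp only: c_coeff_of_nat lowering_coeff_def) (simp add: field_simps)
  qed
  show ?thesis
    unfolding 3 power_divide residual_norm_sq unfolding 1 2 c_coeff_of_nat
    using mnorm_pos[of \<alpha>] mnorm_pos[of "\<alpha> + axis p 1"] by (simp add: field_simps)
qed

lemma Gamma_set_shift:
  fixes \<alpha> :: "nat ^ 'n"
  shows "(\<chi> j. int (\<alpha> $ j)) - unit_index p \<in> Gamma_set"
proof -
  have "{j. ((\<chi> j. int (\<alpha> $ j)) - unit_index p) $ j = -1} \<subseteq> {p}"
    by (auto simp: axis_def split: if_splits)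
  then have "card {j. ((\<chi> j. int (\<alpha> $ j)) - unit_index p) $ j = -1} \<le> card {p}"
    by (intro card_mono) simp_all
  then show ?thesis
    by (auto simp: Gamma_set_def axis_def)
qed

text \<open>
  The map \<open>(\<alpha>, p) \<mapsto> (\<alpha> - e\<^sub>p, p)\<close> is a bijection from all pairs onto the pairs \<open>(\<gamma>, p)\<close> with \<open>\<gamma>\<close> in
  \<open>Gamma_set\<close> and \<open>\<gamma> + e\<^sub>p \<ge> 0\<close>, so both sides bound the same set of numbers, up to taking squares.
\<close>

lemma coefficient_condition_iff:
  "(\<exists>C. \<forall>\<gamma>\<in>Gamma_set. \<forall>p. (\<forall>j. (\<gamma> + unit_index p) $ j \<ge> 0) \<longrightarrow>
       c_coeff M (\<gamma> + unit_index p) / c_coeff M (\<gamma> + 2 *s unit_index p)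
         - c_coeff M \<gamma> / c_coeff M (\<gamma> + unit_index p) < C)
    \<longleftrightarrow> (\<exists>K\<ge>0. \<forall>\<alpha> p. L2_norm M (residual p \<alpha>) \<le> K * mnorm \<alpha>)"
    (is "?coeff \<longleftrightarrow> ?res")
proof
  assume ?coeff
  then obtain C where C: "\<And>\<gamma> p. \<gamma> \<in> Gamma_set \<Longrightarrow> (\<forall>j. (\<gamma> + unit_index p) $ j \<ge> 0) \<Longrightarrow>
       c_coeff M (\<gamma> + unit_index p) / c_coeff M (\<gamma> + 2 *s unit_index p)
         - c_coeff M \<gamma> / c_coeff M (\<gamma> + unit_index p) < C"
    by blast
  have "L2_norm M (residual p \<alpha>) \<le> sqrt (max C 0) * mnorm \<alpha>" for \<alpha> p
  proof -
    have "(L2_norm M (residual p \<alpha>) / mnorm \<alpha>)\<^sup>2 < C"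
      using C[OF Gamma_set_shift[of \<alpha> p], of p] unfolding coefficient_gap by simp
    then have "L2_norm M (residual p \<alpha>) / mnorm \<alpha> \<le> sqrt (max C 0)"
      by (intro real_le_rsqrt) simp
    then show ?thesis
      using mnorm_pos[of \<alpha>] by (simp add: field_simps)
  qed
  then show ?res
    by (intro exI[of _ "sqrt (max C 0)"]) simp
next
  assume ?res
  then obtain K where K: "K \<ge> 0" "\<And>\<alpha> p. L2_norm M (residual p \<alpha>) \<le> K * mnorm \<alpha>"
    by blast
  show ?coeff
  proof (intro exI ballI allI impI)
    fix \<gamma> :: "int ^ 'n" and p
    assume nonneg: "\<forall>j. (\<gamma> + unit_index p) $ j \<ge> 0"
    define \<alpha> where "\<alpha> = (\<chi> j. nat ((\<gamma> + unit_index p) $ j))"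
    have \<gamma>: "\<gamma> = (\<chi> j. int (\<alpha> $ j)) - unit_index p"
      using nonneg by (simp add: \<alpha>_def vec_eq_iff)
    have "L2_norm M (residual p \<alpha>) / mnorm \<alpha> \<le> K"
      using K(2)[of p \<alpha>] mnorm_pos[of \<alpha>] by (simp add: field_simps)
    then have "(L2_norm M (residual p \<alpha>) / mnorm \<alpha>)\<^sup>2 \<le> K\<^sup>2"
      by (intro power_mono) auto
    then show "c_coeff M (\<gamma> + unit_index p) / c_coeff M (\<gamma> + 2 *s unit_index p)
         - c_coeff M \<gamma> / c_coeff M (\<gamma> + unit_index p) < K\<^sup>2 + 1"
      unfolding \<gamma> coefficient_gap by linarith
  qed
qed

end

section \<open>The canonical solution operator\<close>

lemma sum_over_second_component:
  fixes A :: "('i \<times> 'j :: finite) set"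
  assumes "finite A"
  shows "(\<Sum>(\<alpha>, j)\<in>A. F \<alpha> j) = (\<Sum>j\<in>UNIV. \<Sum>\<alpha> | (\<alpha>, j) \<in> A. F \<alpha> j)"
proof -
  have "(\<Sum>(\<alpha>, j)\<in>A. F \<alpha> j) = (\<Sum>j\<in>UNIV. \<Sum>x | x \<in> A \<and> snd x = j. case x of (\<alpha>, k) \<Rightarrow> F \<alpha> k)"
    by (rule sum.group[symmetric]) (use assms in auto)
  also have "\<dots> = (\<Sum>j\<in>UNIV. \<Sum>\<alpha> | (\<alpha>, j) \<in> A. F \<alpha> j)"
  proof (rule sum.cong[OF refl])
    fix j
    show "(\<Sum>x | x \<in> A \<and> snd x = j. case x of (\<alpha>, k) \<Rightarrow> F \<alpha> k) = (\<Sum>\<alpha> | (\<alpha>, j) \<in> A. F \<alpha> j)"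
      by (rule sum.reindex_bij_witness[of _ "\<lambda>\<alpha>. (\<alpha>, j)" fst]) auto
  qed
  finally show ?thesis .
qed

lemma finite_slice: "finite A \<Longrightarrow> finite {\<alpha>. (\<alpha>, j) \<in> A}"
  by (rule finite_subset[of _ "fst ` A"]) force+

lemma polynomial_form_component:
  assumes "finite A"
  shows "polynomial_form A a z $ j = (\<Sum>\<alpha> | (\<alpha>, j) \<in> A. a \<alpha> j * monomial \<alpha> z)"
proof -
  have "polynomial_form A a z $ j
      = (\<Sum>(\<alpha>, k)\<in>A. if k = j then a \<alpha> k * monomial \<alpha> z else 0)"
    unfolding polynomial_form_def by (auto simp: sum_component axis_def intro!: sum.cong)
  also have "\<dots> = (\<Sum>k\<in>UNIV. if k = j then (\<Sum>\<alpha> | (\<alpha>, k) \<in> A. a \<alpha> k * monomial \<alpha> z) else 0)"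
    unfolding sum_over_second_component[OF assms] by (intro sum.cong) auto
  also have "\<dots> = (\<Sum>\<alpha> | (\<alpha>, j) \<in> A. a \<alpha> j * monomial \<alpha> z)"
    by simp
  finally show ?thesis .
qed

lemma component_norm_le_form_norm: "L2_norm M (\<lambda>z. \<omega> z $ j) \<le> form_norm M \<omega>"
  unfolding form_norm_def by (rule real_le_rsqrt, rule member_le_sum) auto

context orthogonal_monomials
begin

text \<open>
  Testing the operator on \<open>z\<^sup>\<alpha> dzbar\<^sub>p\<close>, a form with norm \<open>\<parallel>z\<^sup>\<alpha>\<parallel>\<close>, suffices.
\<close>

lemma residual_bound_if_operator_bounded:
  assumes "canonical_solution_operator_bounded M"
  shows "\<exists>K\<ge>0. \<forall>\<alpha> p. L2_norm M (residual p \<alpha>) \<le> K * mnorm \<alpha>"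
proof -
  obtain T where T: "bounded_operator M T"
    and ext: "\<And>A a. finite A \<Longrightarrow>
      AE z in M. T (polynomial_form A a) z = canonical_solution_poly M A a z"
    using assms by (auto simp: canonical_solution_operator_bounded_def)
  obtain B where B: "\<And>\<omega>. \<omega> \<in> A2_form M \<Longrightarrow> L2_norm M (T \<omega>) \<le> B * form_norm M \<omega>"
    using T unfolding bounded_operator_def by blast
  have "L2_norm M (residual p \<alpha>) \<le> max B 0 * mnorm \<alpha>" for \<alpha> p
  proof -
    let ?\<omega> = "polynomial_form {(\<alpha>, p)} (\<lambda>_ _. 1)"
    have comp: "(\<lambda>z. ?\<omega> z $ j) = (if j = p then monomial \<alpha> else (\<lambda>_. 0))" for j
      by (auto simp: polynomial_form_def axis_def)
    have \<omega>: "?\<omega> \<in> A2_form M"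
      using scaled_monomial_A2[of 1 \<alpha>] scaled_monomial_A2[of 0 \<alpha>]
      by (auto simp: A2_form_def comp)
    have "form_norm M ?\<omega> = sqrt (\<Sum>j\<in>UNIV. if j = p then (mnorm \<alpha>)\<^sup>2 else 0)"
      unfolding form_norm_def comp by (intro arg_cong[of _ _ sqrt] sum.cong) auto
    then have norm: "form_norm M ?\<omega> = mnorm \<alpha>"
      by simp
    have "AE z in M. T ?\<omega> z = canonical_solution M \<alpha> p z"
      using ext[of "{(\<alpha>, p)}" "\<lambda>_ _. 1"] by (simp add: canonical_solution_poly_def)
    then have "AE z in M. T ?\<omega> z = residual p \<alpha> z"
      using canonical_solution_residual(2)[of \<alpha> p] by eventually_elim simp
    moreover have "T ?\<omega> \<in> L2 M"
      using T \<omega> by (auto simp: bounded_operator_def)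
    ultimately have "L2_norm M (residual p \<alpha>) = L2_norm M (T ?\<omega>)"
      by (intro L2_norm_cong_AE[symmetric] residual_L2)
    also have "\<dots> \<le> B * mnorm \<alpha>"
      using B[OF \<omega>] by (simp add: norm)
    also have "\<dots> \<le> max B 0 * mnorm \<alpha>"
      by (intro mult_right_mono) auto
    finally show ?thesis .
  qed
  then show ?thesis
    by (intro exI[of _ "max B 0"]) simp
qed

text \<open>
  The operator is assembled from the extensions \<open>S\<^sub>p\<close> of \<open>z\<^sup>\<alpha> \<mapsto> u\<^sub>\<alpha>\<^sub>,\<^sub>p\<close>, each acting on one component of
  the form. Bounding every component by the whole form costs a factor \<open>n\<close> in the constant.
\<close>

lemma operator_bounded_if_residual_bound:
  assumes "0 \<le> K" and bound: "\<And>\<alpha> p. L2_norm M (residual p \<alpha>) \<le> K * mnorm \<alpha>"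
  shows "canonical_solution_operator_bounded M"
proof -
  have family: "orthogonal_family_map M monomial (residual p) K" for p
    by unfold_locales
      (simp_all add: monomial_L2 residual_L2 orthogonal residual_orthogonal assms)
  define S where "S p = orthogonal_family_map.extension M monomial (residual p)" for p
  define T :: "(complex ^ 'n \<Rightarrow> complex ^ 'n) \<Rightarrow> complex ^ 'n \<Rightarrow> complex"
    where "T \<omega> z = (\<Sum>p\<in>UNIV. S p (\<lambda>x. \<omega> x $ p) z)" for \<omega> z
  have A2_closure: "A2 M = orthogonal_family_map.span_closure M monomial"
    unfolding orthogonal_family_map.span_closure_def[OF family] A2_def polynomials_def
    by (auto simp: Bex_def) blast+
  note A2_closure' = A2_closure[symmetric]
  note S_L2 = orthogonal_family_map.extension_L2[OF family, unfolded A2_closure', folded S_def]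
  note S_bound = orthogonal_family_map.extension_bound[OF family, unfolded A2_closure', folded S_def]
  note S_linear = orthogonal_family_map.extension_linear[OF family, unfolded A2_closure', folded S_def]
  note S_comb = orthogonal_family_map.extension_comb[OF family, folded S_def]
  have form: "(\<lambda>x. \<omega> x $ p) \<in> A2 M" if "\<omega> \<in> A2_form M" for \<omega> p
    using that by (simp add: A2_form_def)
  have zero_A2: "(\<lambda>_. 0) \<in> A2 M"
    using scaled_monomial_A2[of 0] by simp
  have linear: "AE z in M. T (\<lambda>x. \<omega> x + c *s \<eta> x) z = T \<omega> z + c * T \<eta> z"
    if "\<omega> \<in> A2_form M" "\<eta> \<in> A2_form M" for \<omega> \<eta> c
  proof -
    have "AE z in M. \<forall>p\<in>UNIV. S p (\<lambda>x. \<omega> x $ p + c * \<eta> x $ p) z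
        = S p (\<lambda>x. \<omega> x $ p) z + c * S p (\<lambda>x. \<eta> x $ p) z"
      using that by (intro AE_finite_allI S_linear form) auto
    then show ?thesis
      by (rule eventually_mono) (simp add: T_def sum.distrib sum_distrib_left)
  qed
  have "bounded_operator M T"
    unfolding bounded_operator_def
  proof (intro conjI ballI allI)
    fix \<omega>
    assume "\<omega> \<in> A2_form M"
    then show "T \<omega> \<in> L2 M"
      unfolding T_def by (intro L2_sum S_L2 form)
  next
    fix \<omega> \<eta>
    assume "\<omega> \<in> A2_form M" "\<eta> \<in> A2_form M"
    then show "AE z in M. T (\<lambda>x. \<omega> x + \<eta> x) z = T \<omega> z + T \<eta> z"
      using linear[of \<omega> \<eta> 1] by simp
  next
    fix a \<omega>
    assume \<omega>: "\<omega> \<in> A2_form M"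
    have zero: "(\<lambda>_. 0) \<in> A2_form M"
      using zero_A2 by (simp add: A2_form_def)
    (* T 0 = T 0 + T 0 almost everywhere; with this, homogeneity is additivity with first summand 0 *)
    have "AE z in M. T (\<lambda>_. 0) z = 0"
      using linear[OF zero zero, of 1] by simp
    then show "AE z in M. T (\<lambda>x. a *s \<omega> x) z = a * T \<omega> z"
      using linear[OF zero \<omega>, of a] by eventually_elim simp
  next
    have "L2_norm M (T \<omega>) \<le> (real CARD('n) * K) * form_norm M \<omega>" if "\<omega> \<in> A2_form M" for \<omega>
    proof -
      have "L2_norm M (T \<omega>) \<le> (\<Sum>p\<in>UNIV. L2_norm M (S p (\<lambda>x. \<omega> x $ p)))"
        unfolding T_def using that by (intro L2_norm_sum_le S_L2 form)
      also have "\<dots> \<le> (\<Sum>p\<in>(UNIV :: 'n set). K * form_norm M \<omega>)"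
        using that assms(1)
        by (intro sum_mono order_trans[OF S_bound] form mult_left_mono component_norm_le_form_norm)
      finally show ?thesis
        by simp
    qed
    then show "\<exists>B. \<forall>\<omega>\<in>A2_form M. L2_norm M (T \<omega>) \<le> B * form_norm M \<omega>"
      by blast
  qed
  moreover have "AE z in M. T (polynomial_form A a) z = canonical_solution_poly M A a z"
    if A: "finite A" for A a
  proof -
    have "AE z in M. \<forall>p\<in>UNIV. S p (\<lambda>x. polynomial_form A a x $ p) z
        = (\<Sum>\<alpha> | (\<alpha>, p) \<in> A. a \<alpha> p * residual p \<alpha> z)"
      unfolding polynomial_form_component[OF A]
      by (intro AE_finite_allI S_comb finite_slice A finite)
    moreover have "AE z in M. \<forall>(\<alpha>, p)\<in>A. canonical_solution M \<alpha> p z = residual p \<alpha> z"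
      using A by (intro AE_finite_allI) (auto simp: canonical_solution_residual(2) split: prod.split)
    ultimately show ?thesis
    proof eventually_elim
      case (elim z)
      have "canonical_solution_poly M A a z = (\<Sum>(\<alpha>, p)\<in>A. a \<alpha> p * residual p \<alpha> z)"
        unfolding canonical_solution_poly_def using elim(2) by (intro sum.cong) auto
      also have "\<dots> = T (polynomial_form A a) z"
        unfolding sum_over_second_component[OF A] T_def using elim(1) by simp
      finally show ?case
        by simp
    qed
  qed
  ultimately show ?thesis
    unfolding canonical_solution_operator_bounded_def by blast
qed

end

theorem theorem1:
  fixes M :: "(complex ^ 'n) measure"
  assumes borel: "sets M = sets borel"
    and orthogonal: "\<And>\<alpha> \<beta>. \<alpha> \<noteq> \<beta> \<Longrightarrow> L2_inner M (monomial \<alpha>) (monomial \<beta>) = 0"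
    and finite_norm: "\<And>\<alpha>. integrable M (\<lambda>z. (cmod (monomial \<alpha> z))\<^sup>2)"
    and positive_norm: "\<And>\<alpha>. 0 < (LINT z|M. (cmod (monomial \<alpha> z))\<^sup>2)"
  shows "canonical_solution_operator_bounded M \<longleftrightarrow>
    (\<exists>C. \<forall>\<gamma>\<in>Gamma_set. \<forall>p. (\<forall>j. (\<gamma> + unit_index p) $ j \<ge> 0) \<longrightarrow>
       c_coeff M (\<gamma> + unit_index p) / c_coeff M (\<gamma> + 2 *s unit_index p)
         - c_coeff M \<gamma> / c_coeff M (\<gamma> + unit_index p) < C)"
proof -
  interpret orthogonal_monomials M
    using assms by unfold_locales
  show ?thesis
    unfolding coefficient_condition_iff
    using residual_bound_if_operator_bounded operator_bounded_if_residual_bound by blast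
qed

end
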